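(* Let $0<q<1$, let $r$ be a positive integer and $n$ an integer or half-integer such that $n\ge r-1/2$. Then $$\sum_{k_1,\dots,k_r=-n}^n\ \prod_{1\le i<j\le r}\big|[k_i-k_j]_q\,[k_i+k_j]_q\big|\ \prod_{i=1}^r\big|[k_i]_q\big|\,q^{\binom{k_i-r+i}{2}-\binom{\lceil n\rceil-n}{2}}\begin{bmatrix}2n\\ n+k_i\end{bmatrix}_q$$ $$=2^r\,r!\prod_{i=1}^r(-q;q^{1/2})_{2n-2i}\,\frac{\Gamma_q(i)}{\Gamma_q(\frac32)}\cdot\frac{\Gamma_q(2n+1)\,\Gamma_q(\lceil n\rceil-i+\frac32)}{\Gamma_q(2n-i+2)\,\Gamma_q(\lceil n\rceil-i+1)}.$$
   Context: Each $k_i$ runs over $\{-n,-n+1,\dots,n\}$ (half-integers if $n$ is a half-integer, i.e. an element of $\frac12+\mathbb{Z}$). Notation: $\binom{x}{2}=x(x-1)/2$ for all real $x$; $(a;q)_\infty=\prod_{k\ge1}(1-aq^{k-1})$, $(a;q)_k=(a;q)_\infty/(aq^k;q)_\infty$ for any integer $k$ (so $(a;q)_{-1}=1/(1-aq^{-1})$), and likewise with base $q^{1/2}$; $\begin{bmatrix}N\\ M\end{bmatrix}_q=\frac{(q;q)_N}{(q;q)_M(q;q)_{N-M}}$ for integers $0\le M\le N$; $[x]_q=\frac{1-q^x}{1-q}$; $\Gamma_q(x)=(1-q)^{1-x}\frac{(q;q)_\infty}{(q^x;q)_\infty}$. *)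

theory Defs
  imports "HOL-Analysis.Analysis"
begin

definition qpoch_inf :: "real \<Rightarrow> real \<Rightarrow> real" where
  "qpoch_inf a q = (\<Prod>k. 1 - a * q ^ k)"

text \<open>The index of the shifted factorial may be negative: \<open>qpoch a q (-1) = 1 / (1 - a / q)\<close>.\<close>

definition qpoch :: "real \<Rightarrow> real \<Rightarrow> int \<Rightarrow> real" where
  "qpoch a q k = qpoch_inf a q / qpoch_inf (a * q powi k) q"

text \<open>Only meaningful for \<open>0 \<le> M \<le> N\<close>.\<close>

definition qbinomial :: "real \<Rightarrow> int \<Rightarrow> int \<Rightarrow> real" where
  "qbinomial q N M = qpoch q q N / (qpoch q q M * qpoch q q (N - M))"

definition qbracket :: "real \<Rightarrow> real \<Rightarrow> real" where
  "qbracket q x = (1 - q powr x) / (1 - q)"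

definition qGamma :: "real \<Rightarrow> real \<Rightarrow> real" where
  "qGamma q x = (1 - q) powr (1 - x) * (qpoch_inf q q / qpoch_inf (q powr x) q)"

text \<open>The range \<open>-n, -n + 1, \<dots>, n\<close> in steps of one, also for half-integral \<open>n\<close>.\<close>

definition unit_steps :: "real \<Rightarrow> real set" where
  "unit_steps n = {k. - n \<le> k \<and> k \<le> n \<and> n + k \<in> \<int>}"

lemma finite_unit_steps: "finite (unit_steps n)"
proof (rule finite_subset)
  show "unit_steps n \<subseteq> (\<lambda>j. real_of_int j - n) ` {0..\<lfloor>2 * n\<rfloor>}"
  proof
    fix k assume k: "k \<in> unit_steps n"
    then obtain j :: int where j: "n + k = real_of_int j"
      by (auto simp: unit_steps_def elim: Ints_cases)
    have "0 \<le> real_of_int j" "real_of_int j \<le> 2 * n"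
      using k by (auto simp: unit_steps_def simp flip: j)
    then have "j \<in> {0..\<lfloor>2 * n\<rfloor>}"
      by (simp add: le_floor_iff)
    moreover have "k = real_of_int j - n"
      using j by simp
    ultimately show "k \<in> (\<lambda>j. real_of_int j - n) ` {0..\<lfloor>2 * n\<rfloor>}"
      by blast
  qed
qed simp

lemma gchoose_2_real: "(x::real) gchoose 2 = x * (x - 1) / 2"
  by (simp add: gbinomial_prod_rev numeral_2_eq_2)

text \<open>
  When \<open>2 n\<close> and \<open>n + k\<close> are integers, the floors in \<open>qbinomial q \<lfloor>2 * n\<rfloor> \<lfloor>n + k\<rfloor>\<close> and
  \<open>qpoch (- q) (sqrt q) (\<lfloor>2 * n\<rfloor> - 2 * int i)\<close> merely convert reals to the type of integers;
  nothing is rounded.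
\<close>

lemma floor_double_exact:
  assumes "n \<in> \<int> \<or> n - 1 / 2 \<in> \<int>"
  shows "real_of_int \<lfloor>2 * n\<rfloor> = 2 * n"
proof -
  have "2 * n = n + n" "2 * n = (n - 1 / 2) + (n - 1 / 2) + 1"
    by simp_all
  with assms have "2 * n \<in> \<int>"
    by (metis Ints_1 Ints_add)
  then show ?thesis
    by (auto elim: Ints_cases)
qed

lemma floor_index_exact:
  assumes "k \<in> unit_steps n"
  shows "real_of_int \<lfloor>n + k\<rfloor> = n + k"
  using assms by (auto simp: unit_steps_def elim: Ints_cases)

end

theory Submission
  imports Defs
begin

text \<open>
  Put \<open>q = exp (- 2 c)\<close> and work with the symmetric q-numbers
  \<open>snum c x = (q^(x/2) - q^(-x/2)) / (q^(1/2) - q^(-1/2)) = sinh (c x) / sinh c\<close>.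
  In terms of these all powers of \<open>q\<close> in the summand that depend on \<open>k\<close> cancel
  (\<open>summand_factor_eq\<close>), and what is left, a constant times
  \<open>(\<Prod>i<j. \<bar>snum (k_i - k_j) snum (k_i + k_j)\<bar>) (\<Prod>i. \<bar>snum k_i\<bar> W_0 (k_i))\<close>,
  is invariant under permutations and sign changes of the \<open>k_i\<close>. Here \<open>W_i\<close> denotes the
  symmetric q-binomial coefficient with top entry \<open>2 n - 2 i\<close>, centred at \<open>0\<close>.

  Since \<open>snum (a - b) snum (a + b)\<close> is the difference of the values at \<open>a\<close> and \<open>b\<close> of a
  function that increases with the absolute value, the first product is a Vandermonde product
  times \<open>\<Prod> sgn (\<bar>k_i\<bar> - \<bar>k_j\<bar>)\<close>. Against the antisymmetric sign product, the Vandermonde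
  product may be replaced by \<open>r!\<close> times a single product \<open>\<Prod> p_i\<close> of arbitrary monic polynomials
  of degrees \<open>0, \<dots>, r - 1\<close> (\<open>sum_pair_prod_antisymmetrize\<close>). The Newton polynomials whose nodes
  are the values at \<open>n, n - 1, \<dots>\<close> turn \<open>W_0\<close> into a constant times \<open>W_i\<close> (\<open>weight_zero_eq\<close>).

  It remains to sum \<open>\<Prod> sgn (\<bar>k_i\<bar> - \<bar>k_j\<bar>)\<close> against functions \<open>\<phi>_i\<close> of one variable each. By
  Schur's evaluation of the Pfaffian of \<open>(x_i - x_j) / (x_i + x_j)\<close>, of which \<open>sgn\<close> is a limiting
  case, the sign product is a Pfaffian: a polynomial in the single signs in whose monomials no
  index occurs twice. So the sum is the Pfaffian of the same shape in the sums over one and over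
  two variables. For \<open>\<phi>_i (k) = \<bar>snum k\<bar> W_i (k)\<close> both kinds telescope, and the double sums equal the
  product of the single sums times \<open>snum (m_i - m_j) / snum (m_i + m_j)\<close>, where \<open>m_i = n - i\<close>
  (\<open>sum_weight_single\<close>, \<open>sum_weight_double\<close>). This quotient is again of Schur's form, with
  \<open>x_i = tanh (c m_i)\<close>, so the Pfaffian folds back into a product (\<open>sum_pair_prod_kernel\<close>).

  The remaining one-parameter identity between the single sums and the q-Gamma quotients is an
  induction on \<open>2 n\<close> in steps of two (\<open>qGamma_quotient_eq_tail\<close>).
\<close>

section \<open>Divided differences and the partial fractions of Schur\<close>

text \<open>
  Lagrange interpolation at one more node than the degree reproduces \<open>p\<close>; compare leading
  coefficients.
\<close>

lemma divided_difference_lead_coeff: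
  fixes X :: "'a :: field set" and p :: "'a poly"
  assumes "finite X" and card: "card X = Suc (degree p)"
  shows "(\<Sum>x\<in>X. poly p x / (\<Prod>y\<in>X - {x}. x - y)) = lead_coeff p"
proof -
  define L where "L x = (\<Prod>y\<in>X - {x}. [:- y, 1:])" for x
  define c where "c x = poly p x / (\<Prod>y\<in>X - {x}. x - y)" for x
  define Q where "Q = (\<Sum>x\<in>X. smult (c x) (L x))"
  have deg_L: "degree (L x) = degree p" and coeff_L: "coeff (L x) (degree p) = 1" if "x \<in> X" for x
  proof -
    have "degree (L x) = (\<Sum>y\<in>X - {x}. degree [:- y, 1:])"
      unfolding L_def by (rule degree_prod_eq_sum_degree) auto
    then show *: "degree (L x) = degree p"
      using card that \<open>finite X\<close> by simp
    have "lead_coeff (L x) = 1"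
      unfolding L_def by (simp add: lead_coeff_prod)
    then show "coeff (L x) (degree p) = 1"
      by (simp add: *)
  qed
  have "degree Q \<le> degree p"
    unfolding Q_def by (intro degree_sum_le) (use deg_L \<open>finite X\<close> in \<open>auto intro: order.trans[OF degree_smult_le]\<close>)
  have poly_Q: "poly Q x = poly p x" if "x \<in> X" for x
  proof -
    have zero: "poly (L y) x = 0" if "y \<in> X - {x}" for y
      using \<open>x \<in> X\<close> that \<open>finite X\<close> unfolding L_def by (auto simp: poly_prod)
    have "poly Q x = c x * poly (L x) x + (\<Sum>y\<in>X - {x}. c y * poly (L y) x)"
      unfolding Q_def using that \<open>finite X\<close> by (simp add: poly_sum sum.remove)
    also have "(\<Sum>y\<in>X - {x}. c y * poly (L y) x) = 0"
      by (rule sum.neutral) (simp add: zero)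
    also have "poly (L x) x = (\<Prod>y\<in>X - {x}. x - y)"
      unfolding L_def by (simp add: poly_prod)
    also have "(\<Prod>y\<in>X - {x}. x - y) \<noteq> 0"
      using \<open>finite X\<close> by auto
    then have "c x * (\<Prod>y\<in>X - {x}. x - y) + 0 = poly p x"
      by (simp add: c_def)
    finally show ?thesis .
  qed
  have "p = Q"
    by (rule poly_eqI_degree[of X])
       (use poly_Q card \<open>degree Q \<le> degree p\<close> in auto)
  have "lead_coeff p = coeff Q (degree p)"
    using \<open>p = Q\<close> by simp
  also have "\<dots> = (\<Sum>x\<in>X. c x)"
    unfolding Q_def by (simp add: coeff_sum coeff_L)
  finally show ?thesis
    by (simp add: c_def)
qed

text \<open>
  This is the divided difference of \<open>\<Prod>y\<in>Y. (y + X)\<close>, which has leading coefficient \<open>1\<close>, at the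
  nodes \<open>0\<close> and \<open>Y\<close>: the node \<open>0\<close> contributes \<open>(- 1) ^ card Y\<close>, and each \<open>y \<in> Y\<close> contributes twice
  the product on the left. If \<open>0 \<in> Y\<close>, the nodes would collide, but the term of \<open>0\<close> is then a sign
  and \<open>0\<close> drops out of the other products.
\<close>

lemma sum_prod_add_over_diff:
  fixes Y :: "real set"
  assumes "finite Y"
  shows "(\<Sum>y\<in>Y. \<Prod>z\<in>Y - {y}. (y + z) / (y - z)) = of_bool (odd (card Y))"
proof -
  have nonzero: "(\<Sum>y\<in>Y. \<Prod>z\<in>Y - {y}. (y + z) / (y - z)) = of_bool (odd (card Y))"
    if "finite Y" "0 \<notin> Y" for Y :: "real set"
  proof -
    define F where "F = (\<Prod>y\<in>Y. [:y, 1:])"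
    have deg: "degree F = card Y"
      unfolding F_def by (subst degree_prod_eq_sum_degree) auto
    have lead: "lead_coeff F = 1"
      unfolding F_def by (simp add: lead_coeff_prod)
    have poly_F: "poly F x = (\<Prod>y\<in>Y. y + x)" for x
      unfolding F_def by (simp add: poly_prod)
    have at_zero: "poly F 0 / (\<Prod>y\<in>Y. 0 - y) = (- 1) ^ card Y"
    proof -
      have "(\<Prod>y\<in>Y. 0 - y) = (- 1) ^ card Y * (\<Prod>y\<in>Y. y)"
        by (simp add: prod_uminus)
      moreover have "(\<Prod>y\<in>Y. y) \<noteq> 0"
        using that by auto
      ultimately show ?thesis
        by (simp add: poly_F field_simps flip: power_mult_distrib)
    qed
    have at_node: "poly F x / (\<Prod>y\<in>insert 0 Y - {x}. x - y)
        = 2 * (\<Prod>z\<in>Y - {x}. (x + z) / (x - z))" if "x \<in> Y" for x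
    proof -
      have "insert 0 Y - {x} = insert 0 (Y - {x})" "0 \<notin> Y - {x}" "x \<noteq> 0"
        using that \<open>0 \<notin> Y\<close> by auto
      then have "(\<Prod>y\<in>insert 0 Y - {x}. x - y) = x * (\<Prod>y\<in>Y - {x}. x - y)"
        using \<open>finite Y\<close> by simp
      moreover have "poly F x = 2 * x * (\<Prod>z\<in>Y - {x}. x + z)"
        using that \<open>finite Y\<close> by (simp add: poly_F prod.remove add.commute)
      ultimately show ?thesis
        using \<open>x \<noteq> 0\<close> by (simp add: prod_dividef)
    qed
    have "1 = (\<Sum>x\<in>insert 0 Y. poly F x / (\<Prod>y\<in>insert 0 Y - {x}. x - y))"
      using divided_difference_lead_coeff[of "insert 0 Y" F] that deg lead by simp
    also have "\<dots> = (- 1) ^ card Y + (\<Sum>x\<in>Y. poly F x / (\<Prod>y\<in>insert 0 Y - {x}. x - y))"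
      using that at_zero by simp
    also have "(\<Sum>x\<in>Y. poly F x / (\<Prod>y\<in>insert 0 Y - {x}. x - y))
        = 2 * (\<Sum>y\<in>Y. \<Prod>z\<in>Y - {y}. (y + z) / (y - z))"
      by (simp add: at_node sum_distrib_left)
    finally show ?thesis
      by (cases "odd (card Y)") auto
  qed
  show ?thesis
  proof (cases "0 \<in> Y")
    case True
    define Z where "Z = Y - {0}"
    have Z: "finite Z" "0 \<notin> Z" and Y: "Y = insert 0 Z"
      using True assms by (auto simp: Z_def)
    have "(\<Sum>y\<in>Y. \<Prod>z\<in>Y - {y}. (y + z) / (y - z))
        = (\<Prod>z\<in>Z. (0 + z) / (0 - z)) + (\<Sum>y\<in>Z. \<Prod>z\<in>Y - {y}. (y + z) / (y - z))"
      using Z by (simp add: Y)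
    also have "(\<Prod>z\<in>Z. (0 + z) / (0 - z)) = (\<Prod>z\<in>Z. - 1)"
      by (rule prod.cong) (use Z in \<open>auto simp: field_simps\<close>)
    also have "(\<Sum>y\<in>Z. \<Prod>z\<in>Y - {y}. (y + z) / (y - z)) = (\<Sum>y\<in>Z. \<Prod>z\<in>Z - {y}. (y + z) / (y - z))"
    proof (rule sum.cong[OF refl])
      fix y assume "y \<in> Z"
      then have "Y - {y} = insert 0 (Z - {y})" "0 \<notin> Z - {y}" "y \<noteq> 0"
        using Z by (auto simp: Y)
      then show "(\<Prod>z\<in>Y - {y}. (y + z) / (y - z)) = (\<Prod>z\<in>Z - {y}. (y + z) / (y - z))"
        using Z by simp
    qed
    finally show ?thesis
      using nonzero[OF Z] Z by (cases "odd (card Z)") (auto simp: Y)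
  qed (use nonzero assms in blast)
qed

text \<open>
  Adding the point \<open>- x\<close> to \<open>Y\<close> multiplies the product belonging to \<open>y\<close> by
  \<open>- (x - y) / (x + y)\<close>. So this is the previous identity for the set \<open>insert (- x) Y\<close> of even
  size, with the term of \<open>- x\<close> moved to the other side.
\<close>

lemma sum_schur_kernel:
  fixes Y :: "real set"
  assumes "finite Y" "odd (card Y)" and sums: "\<And>y. y \<in> Y \<Longrightarrow> x + y \<noteq> 0"
  shows "(\<Sum>y\<in>Y. (x - y) / (x + y) * (\<Prod>z\<in>Y - {y}. (y + z) / (y - z)))
    = (\<Prod>y\<in>Y. (x - y) / (x + y))"
proof -
  have x: "- x \<notin> Y"
    using sums by fastforce
  have "0 = (\<Sum>y\<in>insert (- x) Y. \<Prod>z\<in>insert (- x) Y - {y}. (y + z) / (y - z))"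
    using sum_prod_add_over_diff[of "insert (- x) Y"] assms x by simp
  also have "\<dots> = (\<Prod>z\<in>Y. (- x + z) / (- x - z))
      + (\<Sum>y\<in>Y. \<Prod>z\<in>insert (- x) Y - {y}. (y + z) / (y - z))"
    using assms x by simp
  also have "(\<Prod>z\<in>Y. (- x + z) / (- x - z)) = (\<Prod>y\<in>Y. (x - y) / (x + y))"
  proof (rule prod.cong[OF refl])
    fix z assume "z \<in> Y"
    show "(- x + z) / (- x - z) = (x - z) / (x + z)"
      using minus_divide_divide[of "x - z" "x + z"] by simp
  qed
  also have "(\<Sum>y\<in>Y. \<Prod>z\<in>insert (- x) Y - {y}. (y + z) / (y - z))
      = - (\<Sum>y\<in>Y. (x - y) / (x + y) * (\<Prod>z\<in>Y - {y}. (y + z) / (y - z)))"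
    unfolding sum_negf[symmetric]
  proof (rule sum.cong[OF refl])
    fix y assume "y \<in> Y"
    then have "insert (- x) Y - {y} = insert (- x) (Y - {y})" "- x \<notin> Y - {y}"
      using x by auto
    then have "(\<Prod>z\<in>insert (- x) Y - {y}. (y + z) / (y - z))
        = (y - x) / (y + x) * (\<Prod>z\<in>Y - {y}. (y + z) / (y - z))"
      using \<open>finite Y\<close> by simp
    also have "(y - x) / (y + x) = - ((x - y) / (x + y))"
      by (metis add.commute minus_diff_eq minus_divide_left)
    finally show "(\<Prod>z\<in>insert (- x) Y - {y}. (y + z) / (y - z))
        = - ((x - y) / (x + y) * (\<Prod>z\<in>Y - {y}. (y + z) / (y - z)))"
      by simp
  qed
  finally show ?thesis
    by simp
qed

section \<open>Products over pairs that expand like Pfaffians\<close>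

definition pair_prod :: "(nat \<Rightarrow> nat \<Rightarrow> real) \<Rightarrow> nat set \<Rightarrow> real" where
  "pair_prod t I = (\<Prod>(i, j)\<in>{(i, j). i \<in> I \<and> j \<in> I \<and> i < j}. t i j)"

text \<open>
  The sign with which \<open>j\<close> enters an expansion of a Pfaffian indexed by \<open>I\<close>.
\<close>

definition pos_sign :: "nat set \<Rightarrow> nat \<Rightarrow> real" where
  "pos_sign I j = (- 1) ^ card {i \<in> I. i < j}"

lemma pair_prod_empty [simp]: "pair_prod t {} = 1"
  by (simp add: pair_prod_def)

lemma finite_pairs: "finite I \<Longrightarrow> finite {(i, j). i \<in> I \<and> j \<in> I \<and> i < (j :: nat)}"
  by (rule finite_subset[of _ "I \<times> I"]) auto

lemma pair_prod_cong:
  assumes "\<And>i j. i \<in> I \<Longrightarrow> j \<in> I \<Longrightarrow> i < j \<Longrightarrow> t i j = t' i j"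
  shows "pair_prod t I = pair_prod t' I"
  unfolding pair_prod_def by (rule prod.cong) (use assms in auto)

lemma pair_prod_remove:
  assumes "finite I" "j \<in> I"
  shows "pair_prod t I
    = (\<Prod>i\<in>{i \<in> I. i < j}. t i j) * (\<Prod>i\<in>{i \<in> I. j < i}. t j i) * pair_prod t (I - {j})"
proof -
  let ?P = "\<lambda>I. {(i, j). i \<in> I \<and> j \<in> I \<and> i < (j :: nat)}"
  let ?A = "(\<lambda>i. (i, j)) ` {i \<in> I. i < j}" and ?B = "(\<lambda>i. (j, i)) ` {i \<in> I. j < i}"
  have split: "?P I = ?A \<union> (?B \<union> ?P (I - {j}))"
    using assms by auto
  have "pair_prod t I = (\<Prod>(i, j)\<in>?A. t i j) * (\<Prod>(i, j)\<in>?B \<union> ?P (I - {j}). t i j)"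
    unfolding pair_prod_def split
    by (rule prod.union_disjoint) (use assms finite_pairs[of "I - {j}"] in auto)
  also have "(\<Prod>(i, j)\<in>?B \<union> ?P (I - {j}). t i j) = (\<Prod>(i, j)\<in>?B. t i j) * pair_prod t (I - {j})"
    unfolding pair_prod_def
    by (rule prod.union_disjoint) (use assms finite_pairs[of "I - {j}"] in auto)
  also have "(\<Prod>(i, j)\<in>?A. t i j) = (\<Prod>i\<in>{i \<in> I. i < j}. t i j)"
    by (subst prod.reindex) (auto simp: inj_on_def)
  also have "(\<Prod>(i, j)\<in>?B. t i j) = (\<Prod>i\<in>{i \<in> I. j < i}. t j i)"
    by (subst prod.reindex) (auto simp: inj_on_def)
  finally show ?thesis
    by (simp add: mult.assoc)
qed

lemma prod_split_at:
  fixes f :: "nat \<Rightarrow> real"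
  assumes "finite I"
  shows "(\<Prod>i\<in>I - {j}. f i) = (\<Prod>i\<in>{i \<in> I. i < j}. f i) * (\<Prod>i\<in>{i \<in> I. j < i}. f i)"
proof -
  have "I - {j} = {i \<in> I. i < j} \<union> {i \<in> I. j < i}"
    by auto
  then show ?thesis
    using assms by (simp add: prod.union_disjoint[symmetric] disjoint_iff)
qed

lemma pair_prod_remove_antisym:
  assumes "finite I" "j \<in> I" and antisym: "\<And>i. i \<in> I \<Longrightarrow> t i j = - t j i"
  shows "pair_prod t I = pos_sign I j * (\<Prod>i\<in>I - {j}. t j i) * pair_prod t (I - {j})"
proof -
  have "(\<Prod>i\<in>{i \<in> I. i < j}. t i j) = (\<Prod>i\<in>{i \<in> I. i < j}. - t j i)"
    by (rule prod.cong) (use antisym in auto)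
  also have "\<dots> = pos_sign I j * (\<Prod>i\<in>{i \<in> I. i < j}. t j i)"
    by (simp add: prod_uminus pos_sign_def)
  finally show ?thesis
    using assms by (simp add: pair_prod_remove[of I j t] prod_split_at[of I _ j])
qed

lemma pair_prod_remove_sym:
  assumes "finite I" "j \<in> I" and sym: "\<And>i. i \<in> I \<Longrightarrow> t i j = t j i"
  shows "pair_prod t I = (\<Prod>i\<in>I - {j}. t j i) * pair_prod t (I - {j})"
proof -
  have "(\<Prod>i\<in>{i \<in> I. i < j}. t i j) = (\<Prod>i\<in>{i \<in> I. i < j}. t j i)"
    by (rule prod.cong) (use sym in auto)
  then show ?thesis
    using assms by (simp add: pair_prod_remove[of I j t] prod_split_at[of I _ j])
qed

lemma pair_prod_insert_min:
  assumes "finite I" "\<And>i. i \<in> I \<Longrightarrow> a < i"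
  shows "pair_prod t (insert a I) = (\<Prod>i\<in>I. t a i) * pair_prod t I"
proof -
  have "a \<notin> I"
    using assms by blast
  have sets: "{i \<in> insert a I. i < a} = {}" "{i \<in> insert a I. a < i} = I" "insert a I - {a} = I"
    using assms \<open>a \<notin> I\<close> by (auto dest: less_asym)
  show ?thesis
    using pair_prod_remove[of "insert a I" a t] \<open>finite I\<close> unfolding sets by simp
qed

text \<open>
  Schur's Pfaffian in recursive form. The first equation expands a product over an odd index set,
  as a Pfaffian bordered by ones. In the second one, \<open>a\<close> below all of \<open>J\<close> makes the right-hand side
  the pair product over the even set \<open>insert a J\<close>, and the left-hand side its expansion along the row
  of \<open>a\<close>. In each term on the left, \<open>j\<close> (together with \<open>a\<close>) is decoupled from the other indices, so
  that a sum over one variable per index factorizes.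
\<close>

definition pfaffian_kernel :: "(nat \<Rightarrow> nat \<Rightarrow> real) \<Rightarrow> nat set \<Rightarrow> bool" where
  "pfaffian_kernel t I \<longleftrightarrow> (\<forall>J \<subseteq> I. odd (card J) \<longrightarrow>
     (\<Sum>j\<in>J. pos_sign J j * pair_prod t (J - {j})) = pair_prod t J \<and>
     (\<forall>a \<in> I - J. (\<Sum>j\<in>J. t a j * (pos_sign J j * pair_prod t (J - {j})))
        = (\<Prod>j\<in>J. t a j) * pair_prod t J))"

lemma pfaffian_kernel_subset: "pfaffian_kernel t I \<Longrightarrow> J \<subseteq> I \<Longrightarrow> pfaffian_kernel t J"
  unfolding pfaffian_kernel_def by (meson Diff_mono order.trans order_refl subsetD)

text \<open>
  Dividing by the full pair product turns the signed minors into the products of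
  \<open>(y + z) / (y - z)\<close> over the other nodes, so both equations become the partial fraction identities
  above.
\<close>

lemma pfaffian_kernel_schur:
  fixes x :: "nat \<Rightarrow> real"
  assumes "finite I" and inj: "inj_on x I"
    and sums: "\<And>i j. i \<in> I \<Longrightarrow> j \<in> I \<Longrightarrow> i \<noteq> j \<Longrightarrow> x i + x j \<noteq> 0"
  shows "pfaffian_kernel (\<lambda>i j. (x i - x j) / (x i + x j)) I"
  unfolding pfaffian_kernel_def
proof (intro allI impI conjI ballI)
  let ?t = "\<lambda>i j. (x i - x j) / (x i + x j)"
  fix J assume J: "J \<subseteq> I" "odd (card J)"
  have "finite J" and inj_J: "inj_on x J"
    using J \<open>finite I\<close> inj by (auto intro: finite_subset inj_on_subset)
  have cofactor: "pos_sign J j * pair_prod ?t (J - {j})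
      = pair_prod ?t J * (\<Prod>z\<in>x ` J - {x j}. (x j + z) / (x j - z))" if "j \<in> J" for j
  proof -
    have "?t i j = - ?t j i" for i
      by (metis add.commute minus_diff_eq minus_divide_left)
    then have "pair_prod ?t J = pos_sign J j * (\<Prod>i\<in>J - {j}. ?t j i) * pair_prod ?t (J - {j})"
      using pair_prod_remove_antisym[of J j ?t] that \<open>finite J\<close> by blast
    moreover have "x ` J - {x j} = x ` (J - {j})"
      using inj_J that by (auto simp: inj_on_def)
    then have "(\<Prod>z\<in>x ` J - {x j}. (x j + z) / (x j - z)) = (\<Prod>i\<in>J - {j}. (x j + x i) / (x j - x i))"
      using inj_J by (simp add: prod.reindex inj_on_diff)
    moreover have "(\<Prod>i\<in>J - {j}. ?t j i) * (\<Prod>i\<in>J - {j}. (x j + x i) / (x j - x i)) = 1"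
      unfolding prod.distrib[symmetric]
    proof (rule prod.neutral, rule ballI)
      fix i assume i: "i \<in> J - {j}"
      then have "x j + x i \<noteq> 0" "x j - x i \<noteq> 0"
        using sums[of j i] that J inj_J by (auto simp: inj_on_def)
      then show "?t j i * ((x j + x i) / (x j - x i)) = 1"
        by simp
    qed
    ultimately show ?thesis
      by (simp add: mult_ac)
  qed
  have "(\<Sum>j\<in>J. pos_sign J j * pair_prod ?t (J - {j}))
      = pair_prod ?t J * (\<Sum>y\<in>x ` J. \<Prod>z\<in>x ` J - {y}. (y + z) / (y - z))"
    using inj_J by (simp add: cofactor sum.reindex sum_distrib_left)
  then show "(\<Sum>j\<in>J. pos_sign J j * pair_prod ?t (J - {j})) = pair_prod ?t J"
    using J \<open>finite J\<close> inj_J by (simp add: sum_prod_add_over_diff card_image)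
  fix a assume a: "a \<in> I - J"
  have "(\<Sum>j\<in>J. ?t a j * (pos_sign J j * pair_prod ?t (J - {j})))
      = pair_prod ?t J * (\<Sum>y\<in>x ` J. (x a - y) / (x a + y) * (\<Prod>z\<in>x ` J - {y}. (y + z) / (y - z)))"
    using inj_J by (simp add: cofactor sum.reindex sum_distrib_left mult_ac)
  also have "(\<Sum>y\<in>x ` J. (x a - y) / (x a + y) * (\<Prod>z\<in>x ` J - {y}. (y + z) / (y - z)))
      = (\<Prod>y\<in>x ` J. (x a - y) / (x a + y))"
    by (rule sum_schur_kernel) (use a J sums \<open>finite J\<close> inj_J in \<open>auto simp: card_image\<close>)
  also have "\<dots> = (\<Prod>j\<in>J. ?t a j)"
    using inj_J by (simp add: prod.reindex)
  finally show "(\<Sum>j\<in>J. ?t a j * (pos_sign J j * pair_prod ?t (J - {j})))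
      = (\<Prod>j\<in>J. ?t a j) * pair_prod ?t J"
    by (simp add: mult.commute)
qed

lemma tendsto_pair_prod:
  assumes "\<And>i j. i \<in> I \<Longrightarrow> j \<in> I \<Longrightarrow> i < j \<Longrightarrow> ((\<lambda>s. T s i j) \<longlongrightarrow> t i j) F"
  shows "((\<lambda>s. pair_prod (T s) I) \<longlongrightarrow> pair_prod t I) F"
  unfolding pair_prod_def by (rule tendsto_prod) (use assms in auto)

lemma pfaffian_kernel_limit:
  assumes "finite I" and F: "F \<noteq> bot" and kernel: "eventually (\<lambda>s. pfaffian_kernel (T s) I) F"
    and lim: "\<And>i j. i \<in> I \<Longrightarrow> j \<in> I \<Longrightarrow> i \<noteq> j \<Longrightarrow> ((\<lambda>s. T s i j) \<longlongrightarrow> t i j) F"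
  shows "pfaffian_kernel t I"
  unfolding pfaffian_kernel_def
proof (intro allI impI conjI ballI)
  fix J assume J: "J \<subseteq> I" "odd (card J)"
  have lim_J: "((\<lambda>s. pair_prod (T s) J') \<longlongrightarrow> pair_prod t J') F" if "J' \<subseteq> J" for J'
    by (intro tendsto_pair_prod lim) (use J that in auto)
  show "(\<Sum>j\<in>J. pos_sign J j * pair_prod t (J - {j})) = pair_prod t J"
  proof (rule tendsto_unique[OF F])
    show "((\<lambda>s. pair_prod (T s) J) \<longlongrightarrow> pair_prod t J) F"
      by (rule lim_J) simp
    have "((\<lambda>s. \<Sum>j\<in>J. pos_sign J j * pair_prod (T s) (J - {j}))
        \<longlongrightarrow> (\<Sum>j\<in>J. pos_sign J j * pair_prod t (J - {j}))) F"
      by (intro tendsto_intros lim_J) auto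
    moreover have "\<forall>\<^sub>F s in F. (\<Sum>j\<in>J. pos_sign J j * pair_prod (T s) (J - {j})) = pair_prod (T s) J"
      using kernel by eventually_elim (use J in \<open>auto simp: pfaffian_kernel_def\<close>)
    ultimately show "((\<lambda>s. pair_prod (T s) J) \<longlongrightarrow> (\<Sum>j\<in>J. pos_sign J j * pair_prod t (J - {j}))) F"
      by (rule Lim_transform_eventually)
  qed
  fix a assume a: "a \<in> I - J"
  have lim_a: "((\<lambda>s. T s a j) \<longlongrightarrow> t a j) F" if "j \<in> J" for j
    by (rule lim) (use a J that in auto)
  show "(\<Sum>j\<in>J. t a j * (pos_sign J j * pair_prod t (J - {j}))) = (\<Prod>j\<in>J. t a j) * pair_prod t J"
  proof (rule tendsto_unique[OF F])
    show "((\<lambda>s. (\<Prod>j\<in>J. T s a j) * pair_prod (T s) J) \<longlongrightarrow> (\<Prod>j\<in>J. t a j) * pair_prod t J) F"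
      by (intro tendsto_intros lim_J lim_a) auto
    have "((\<lambda>s. \<Sum>j\<in>J. T s a j * (pos_sign J j * pair_prod (T s) (J - {j})))
        \<longlongrightarrow> (\<Sum>j\<in>J. t a j * (pos_sign J j * pair_prod t (J - {j})))) F"
      by (intro tendsto_intros lim_J lim_a) auto
    moreover have "\<forall>\<^sub>F s in F. (\<Sum>j\<in>J. T s a j * (pos_sign J j * pair_prod (T s) (J - {j})))
        = (\<Prod>j\<in>J. T s a j) * pair_prod (T s) J"
      using kernel by eventually_elim (use J a in \<open>auto simp: pfaffian_kernel_def\<close>)
    ultimately show "((\<lambda>s. (\<Prod>j\<in>J. T s a j) * pair_prod (T s) J)
        \<longlongrightarrow> (\<Sum>j\<in>J. t a j * (pos_sign J j * pair_prod t (J - {j})))) F"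
      by (rule Lim_transform_eventually)
  qed
qed

lemma schur_quotient_exp_eq_tanh:
  fixes a b :: real
  shows "(exp (2 * a) - exp (2 * b)) / (exp (2 * a) + exp (2 * b)) = tanh (a - b)"
proof -
  have e: "exp (- 2 * (a - b)) = exp (2 * b) / exp (2 * a)"
    by (simp add: exp_diff[symmetric] algebra_simps)
  have "(1 - exp (2 * b) / exp (2 * a)) = (exp (2 * a) - exp (2 * b)) / exp (2 * a)"
    "(1 + exp (2 * b) / exp (2 * a)) = (exp (2 * a) + exp (2 * b)) / exp (2 * a)"
    by (simp_all add: diff_divide_distrib add_divide_distrib)
  then show ?thesis
    unfolding tanh_real_altdef e by simp
qed

text \<open>
  For large \<open>s\<close> the kernel \<open>tanh (s (f i - f j))\<close> is close to \<open>sgn (f i - f j)\<close>, and it has Schur's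
  form with \<open>x i = exp (2 s f i)\<close>. The extra term \<open>i / s\<close> in the exponent separates indices with equal
  values of \<open>f\<close>, which Schur's identity needs, and it is small enough for the limit at ties to be
  \<open>0 = sgn 0\<close>.
\<close>

lemma pfaffian_kernel_sgn:
  fixes f :: "nat \<Rightarrow> real"
  assumes "finite I"
  shows "pfaffian_kernel (\<lambda>i j. sgn (f i - f j)) I"
proof -
  \<comment> \<open>\<open>T s\<close> is the kernel of Schur's form that tends to the sign kernel.\<close>
  define y where "y s i = s * f i + real i / s" for s i
  define T where "T s i j = tanh (y s i - y s j)" for s i j
  have diff: "y s i - y s j = (real i - real j) / s + s * (f i - f j)" for s i j
    by (simp add: y_def algebra_simps diff_divide_distrib)
  have lim0: "((\<lambda>s. (real i - real j) / s) \<longlongrightarrow> 0) at_top" for i j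
    by (rule tendsto_divide_0[OF tendsto_const filterlim_at_top_imp_at_infinity[OF filterlim_ident]])
  have to_top: "filterlim (\<lambda>s. y s i - y s j) at_top at_top" if "f i > f j" for i j
    unfolding diff
    by (intro filterlim_tendsto_add_at_top[OF lim0]
        filterlim_at_top_mult_tendsto_pos[OF tendsto_const _ filterlim_ident])
       (use that in simp)
  have lim_top: "((\<lambda>s. T s i j) \<longlongrightarrow> 1) at_top" if "f i > f j" for i j
    unfolding T_def by (rule filterlim_compose[OF tanh_real_at_top to_top[OF that]])
  have lim: "((\<lambda>s. T s i j) \<longlongrightarrow> sgn (f i - f j)) at_top" for i j
  proof -
    consider "f i > f j" | "f i < f j" | "f i = f j"
      by linarith
    then show ?thesis
    proof cases
      case 2
      have "T s i j = - T s j i" for s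
        by (simp add: T_def flip: tanh_minus)
      then show ?thesis
        using tendsto_minus[OF lim_top[OF 2]] 2 by simp
    next
      case 3
      have "((\<lambda>s. tanh ((real i - real j) / s)) \<longlongrightarrow> tanh 0) at_top"
        by (intro tendsto_tanh lim0) simp
      then show ?thesis
        using 3 by (simp add: T_def diff)
    qed (use lim_top in auto)
  qed
  \<comment> \<open>Schur's form needs distinct nodes; they are distinct for all large \<open>s\<close>.\<close>
  have "\<forall>\<^sub>F s in at_top. y s i \<noteq> y s j" if "i \<noteq> j" for i j
  proof -
    consider "f i > f j" | "f i < f j" | "f i = f j"
      by linarith
    then show ?thesis
    proof cases
      case 1
      from filterlim_at_top_dense[THEN iffD1, OF to_top[OF 1], rule_format, of 0] show ?thesis
        by eventually_elim auto
    next
      case 2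
      from filterlim_at_top_dense[THEN iffD1, OF to_top[OF 2], rule_format, of 0] show ?thesis
        by eventually_elim auto
    next
      case 3
      show ?thesis
        using eventually_gt_at_top[of 0]
      proof eventually_elim
        case (elim s)
        then have "(real i - real j) / s \<noteq> 0"
          using that by simp
        then show ?case
          using diff[of s i j] 3 by auto
      qed
    qed
  qed
  then have "\<forall>\<^sub>F s in at_top. \<forall>(i, j)\<in>I \<times> I - Id. y s i \<noteq> y s j"
    using assms by (subst eventually_ball_finite_distrib) auto
  then have kernel: "\<forall>\<^sub>F s in at_top. pfaffian_kernel (T s) I"
  proof eventually_elim
    case (elim s)
    have inj: "inj_on (\<lambda>i. exp (2 * y s i)) I"
      using elim by (auto simp: inj_on_def)
    have "pfaffian_kernel (\<lambda>i j. (exp (2 * y s i) - exp (2 * y s j)) / (exp (2 * y s i) + exp (2 * y s j))) I"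
    proof (rule pfaffian_kernel_schur[OF assms inj])
      show "exp (2 * y s i) + exp (2 * y s j) \<noteq> 0" for i j
        using exp_gt_zero[of "2 * y s i"] exp_gt_zero[of "2 * y s j"] by linarith
    qed
    then show ?case
      by (simp add: schur_quotient_exp_eq_tanh T_def[abs_def])
  qed
  show ?thesis
    by (rule pfaffian_kernel_limit[OF assms _ kernel lim]) simp
qed

section \<open>Summation of a pair product against one-variable weights\<close>

lemma sum_PiE_insert:
  assumes "j \<notin> I"
  shows "(\<Sum>k\<in>insert j I \<rightarrow>\<^sub>E U. F k) = (\<Sum>x\<in>U. \<Sum>k\<in>I \<rightarrow>\<^sub>E U. F (k(j := x)))"
proof -
  have "(\<Sum>k\<in>insert j I \<rightarrow>\<^sub>E U. F k) = (\<Sum>(x, k)\<in>U \<times> (I \<rightarrow>\<^sub>E U). F (k(j := x)))"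
    unfolding PiE_insert_eq
    by (subst sum.reindex[OF inj_combinator[OF assms]]) (simp add: case_prod_unfold comp_def)
  then show ?thesis
    by (simp add: sum.cartesian_product)
qed

lemma sum_PiE_factor:
  fixes f :: "'b \<Rightarrow> real"
  assumes "j \<notin> I" and "\<And>k x. G (k(j := x)) = G k"
  shows "(\<Sum>k\<in>insert j I \<rightarrow>\<^sub>E U. f (k j) * G k) = (\<Sum>x\<in>U. f x) * (\<Sum>k\<in>I \<rightarrow>\<^sub>E U. G k)"
  using assms by (simp add: sum_PiE_insert sum_product)

lemma sum_PiE_factor2:
  fixes f :: "'b \<Rightarrow> 'b \<Rightarrow> real"
  assumes "i \<notin> I" "j \<notin> I" "i \<noteq> j"
    and "\<And>k x. G (k(i := x)) = G k" "\<And>k x. G (k(j := x)) = G k"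
  shows "(\<Sum>k\<in>insert i (insert j I) \<rightarrow>\<^sub>E U. f (k i) (k j) * G k)
    = (\<Sum>x\<in>U. \<Sum>y\<in>U. f x y) * (\<Sum>k\<in>I \<rightarrow>\<^sub>E U. G k)"
proof -
  have "(\<Sum>k\<in>insert i (insert j I) \<rightarrow>\<^sub>E U. f (k i) (k j) * G k)
      = (\<Sum>x\<in>U. \<Sum>y\<in>U. \<Sum>k\<in>I \<rightarrow>\<^sub>E U. f x y * G k)"
    using assms by (simp add: sum_PiE_insert)
  also have "\<dots> = (\<Sum>x\<in>U. \<Sum>y\<in>U. f x y) * (\<Sum>k\<in>I \<rightarrow>\<^sub>E U. G k)"
    by (simp only: sum_distrib_left[symmetric] sum_distrib_right)
  finally show ?thesis .
qed

lemma pair_prod_fun_upd: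
  assumes "j \<notin> I"
  shows "pair_prod (\<lambda>a b. s ((k(j := x)) a) ((k(j := x)) b)) I = pair_prod (\<lambda>a b. s (k a) (k b)) I"
  by (rule pair_prod_cong) (use assms in auto)

lemma prod_fun_upd:
  assumes "j \<notin> I"
  shows "(\<Prod>i\<in>I. w i ((k(j := x)) i)) = (\<Prod>i\<in>I. w i (k i))"
  by (rule prod.cong) (use assms in auto)

text \<open>
  The principle that lets a product formula for one and two variables propagate to any number of
  variables: if the kernels \<open>s\<close> and \<open>\<tau>\<close> both obey Schur's expansions, the sums on the left obey the
  same recursion as the pair products of \<open>\<tau>\<close>. Expanding the pair product of \<open>s\<close> splits off one
  variable if \<open>card I\<close> is odd, and two variables, one of them with the least index, if it is even;
  the remaining sum is an instance with a smaller index set.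
\<close>

lemma sum_pair_prod_kernel:
  fixes s :: "'b \<Rightarrow> 'b \<Rightarrow> real" and \<tau> :: "nat \<Rightarrow> nat \<Rightarrow> real"
  assumes "finite I"
    and s: "\<And>k. pfaffian_kernel (\<lambda>i j. s (k i) (k j)) I"
    and \<tau>: "pfaffian_kernel \<tau> I"
    and single: "\<And>i. i \<in> I \<Longrightarrow> (\<Sum>x\<in>U. w i x) = h i"
    and double: "\<And>i j. i \<in> I \<Longrightarrow> j \<in> I \<Longrightarrow> i < j \<Longrightarrow>
      (\<Sum>x\<in>U. \<Sum>y\<in>U. w i x * w j y * s x y) = h i * h j * \<tau> i j"
  shows "(\<Sum>k\<in>I \<rightarrow>\<^sub>E U. pair_prod (\<lambda>i j. s (k i) (k j)) I * (\<Prod>i\<in>I. w i (k i)))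
    = (\<Prod>i\<in>I. h i) * pair_prod \<tau> I"
  using assms
proof (induction "card I" arbitrary: I rule: less_induct)
  case less
  define G where "G J k = pair_prod (\<lambda>i j. s (k i) (k j)) J * (\<Prod>i\<in>J. w i (k i))" for J k
  define A where "A J = (\<Sum>k\<in>J \<rightarrow>\<^sub>E U. G J k)" for J
  have G_upd: "G J (k(j := x)) = G J k" if "j \<notin> J" for J k j x
    unfolding G_def using that by (simp add: pair_prod_fun_upd prod_fun_upd del: fun_upd_apply)
  have A_less: "A J = (\<Prod>i\<in>J. h i) * pair_prod \<tau> J" if "J \<subset> I" for J
    unfolding A_def G_def
  proof (rule less.hyps)
    show "card J < card I" "finite J"
      using that less.prems(1) by (auto intro: psubset_card_mono finite_subset)
    show "pfaffian_kernel (\<lambda>i j. s (k i) (k j)) J" "pfaffian_kernel \<tau> J" for k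
      using that pfaffian_kernel_subset less.prems(2,3) by blast+
    show "(\<Sum>x\<in>U. w i x) = h i" if "i \<in> J" for i
      using less.prems(4)[of i] that \<open>J \<subset> I\<close> by blast
    show "(\<Sum>x\<in>U. \<Sum>y\<in>U. w i x * w j y * s x y) = h i * h j * \<tau> i j"
      if "i \<in> J" "j \<in> J" "i < j" for i j
      using less.prems(5)[of i j] that \<open>J \<subset> I\<close> by blast
  qed
  have "A I = (\<Prod>i\<in>I. h i) * pair_prod \<tau> I"
  proof (cases "odd (card I)")
    case True
    have "A I = (\<Sum>k\<in>I \<rightarrow>\<^sub>E U. \<Sum>j\<in>I. pos_sign I j * (w j (k j) * G (I - {j}) k))"
      unfolding A_def
    proof (rule sum.cong[OF refl])
      fix k
      have "G I k = (\<Sum>j\<in>I. pos_sign I j * pair_prod (\<lambda>i j. s (k i) (k j)) (I - {j})) * (\<Prod>i\<in>I. w i (k i))"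
        using less.prems(2)[of k] True unfolding G_def pfaffian_kernel_def by simp
      also have "\<dots> = (\<Sum>j\<in>I. pos_sign I j * (w j (k j) * G (I - {j}) k))"
        unfolding sum_distrib_right
        by (rule sum.cong[OF refl]) (use less.prems(1) in \<open>simp add: G_def prod.remove\<close>)
      finally show "G I k = (\<Sum>j\<in>I. pos_sign I j * (w j (k j) * G (I - {j}) k))" .
    qed
    also have "\<dots> = (\<Sum>j\<in>I. pos_sign I j * (\<Sum>k\<in>I \<rightarrow>\<^sub>E U. w j (k j) * G (I - {j}) k))"
      by (subst sum.swap) (simp add: sum_distrib_left)
    also have "\<dots> = (\<Sum>j\<in>I. pos_sign I j * (h j * A (I - {j})))"
    proof (rule sum.cong[OF refl])
      fix j assume j: "j \<in> I"
      then have "I = insert j (I - {j})"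
        by auto
      then have "(\<Sum>k\<in>I \<rightarrow>\<^sub>E U. w j (k j) * G (I - {j}) k) = h j * A (I - {j})"
        using sum_PiE_factor[where j = j and I = "I - {j}" and G = "G (I - {j})" and f = "w j" and U = U] G_upd less.prems(4)[OF j]
        by (simp add: A_def)
      then show "pos_sign I j * (\<Sum>k\<in>I \<rightarrow>\<^sub>E U. w j (k j) * G (I - {j}) k) = pos_sign I j * (h j * A (I - {j}))"
        by simp
    qed
    also have "\<dots> = (\<Sum>j\<in>I. (\<Prod>i\<in>I. h i) * (pos_sign I j * pair_prod \<tau> (I - {j})))"
    proof (rule sum.cong[OF refl])
      fix j assume j: "j \<in> I"
      then have "I - {j} \<subset> I"
        by auto
      then show "pos_sign I j * (h j * A (I - {j})) = (\<Prod>i\<in>I. h i) * (pos_sign I j * pair_prod \<tau> (I - {j}))"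
        using j less.prems(1) by (simp add: A_less prod.remove)
    qed
    also have "\<dots> = (\<Prod>i\<in>I. h i) * pair_prod \<tau> I"
      using less.prems(3) True unfolding pfaffian_kernel_def by (simp flip: sum_distrib_left)
    finally show ?thesis .
  next
    case even: False
    show ?thesis
    proof (cases "I = {}")
      case False
      define a where "a = Min I"
      define J where "J = I - {a}"
      have I: "I = insert a J" and a: "a \<notin> J" and "finite J" and a_less: "\<And>j. j \<in> J \<Longrightarrow> a < j"
        using Min_in[OF less.prems(1) False] less.prems(1) by (auto simp: a_def J_def order.strict_iff_order)
      have "odd (card J)"
        using even \<open>finite J\<close> a by (simp add: I)
      have expand: "pair_prod t I = (\<Sum>j\<in>J. t a j * (pos_sign J j * pair_prod t (J - {j})))"
        if "pfaffian_kernel t I" for t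
        using that \<open>odd (card J)\<close> a \<open>finite J\<close> a_less unfolding pfaffian_kernel_def I
        by (simp add: pair_prod_insert_min subset_insertI)
      have "A I = (\<Sum>k\<in>I \<rightarrow>\<^sub>E U. \<Sum>j\<in>J. pos_sign J j * (w a (k a) * w j (k j) * s (k a) (k j) * G (J - {j}) k))"
        unfolding A_def
      proof (rule sum.cong[OF refl])
        fix k
        have "G I k = (\<Sum>j\<in>J. s (k a) (k j) * (pos_sign J j * pair_prod (\<lambda>i j. s (k i) (k j)) (J - {j})))
            * (w a (k a) * (\<Prod>i\<in>J. w i (k i)))"
          unfolding G_def expand[OF less.prems(2)] using a \<open>finite J\<close> by (simp add: I)
        also have "\<dots> = (\<Sum>j\<in>J. pos_sign J j * (w a (k a) * w j (k j) * s (k a) (k j) * G (J - {j}) k))"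
          unfolding sum_distrib_right
          by (rule sum.cong[OF refl]) (use \<open>finite J\<close> in \<open>simp add: G_def prod.remove\<close>)
        finally show "G I k = \<dots>" .
      qed
      also have "\<dots> = (\<Sum>j\<in>J. pos_sign J j *
          (\<Sum>k\<in>I \<rightarrow>\<^sub>E U. w a (k a) * w j (k j) * s (k a) (k j) * G (J - {j}) k))"
        by (subst sum.swap) (simp add: sum_distrib_left)
      also have "\<dots> = (\<Sum>j\<in>J. (\<Prod>i\<in>I. h i) * (\<tau> a j * (pos_sign J j * pair_prod \<tau> (J - {j}))))"
      proof (rule sum.cong[OF refl])
        fix j assume j: "j \<in> J"
        then have I_eq: "I = insert a (insert j (J - {j}))" and "J - {j} \<subset> I"
          using I by auto
        have "(\<Sum>k\<in>I \<rightarrow>\<^sub>E U. w a (k a) * w j (k j) * s (k a) (k j) * G (J - {j}) k)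
            = (\<Sum>x\<in>U. \<Sum>y\<in>U. w a x * w j y * s x y) * A (J - {j})"
          unfolding A_def I_eq
          by (rule sum_PiE_factor2[where f = "\<lambda>x y. w a x * w j y * s x y"])
             (use a j G_upd in auto)
        also have "(\<Sum>x\<in>U. \<Sum>y\<in>U. w a x * w j y * s x y) = h a * h j * \<tau> a j"
          by (rule less.prems(5)) (use j I a_less in auto)
        also have "A (J - {j}) = (\<Prod>i\<in>J - {j}. h i) * pair_prod \<tau> (J - {j})"
          by (rule A_less) fact
        finally have "(\<Sum>k\<in>I \<rightarrow>\<^sub>E U. w a (k a) * w j (k j) * s (k a) (k j) * G (J - {j}) k)
            = h a * h j * \<tau> a j * ((\<Prod>i\<in>J - {j}. h i) * pair_prod \<tau> (J - {j}))" .
        moreover have "(\<Prod>i\<in>I. h i) = h a * (h j * (\<Prod>i\<in>J - {j}. h i))"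
          using a j \<open>finite J\<close> by (simp add: I prod.remove)
        ultimately show "pos_sign J j * (\<Sum>k\<in>I \<rightarrow>\<^sub>E U. w a (k a) * w j (k j) * s (k a) (k j) * G (J - {j}) k)
            = (\<Prod>i\<in>I. h i) * (\<tau> a j * (pos_sign J j * pair_prod \<tau> (J - {j})))"
          by simp
      qed
      also have "\<dots> = (\<Prod>i\<in>I. h i) * pair_prod \<tau> I"
        unfolding expand[OF less.prems(3)] by (simp add: sum_distrib_left)
      finally show ?thesis .
    qed (simp add: A_def G_def)
  qed
  then show ?case
    by (simp add: A_def G_def)
qed

section \<open>Vandermonde products under antisymmetric weights\<close>

lemma sum_PiE_reindex:
  assumes "bij_betw \<pi> I J"
  shows "(\<Sum>k\<in>I \<rightarrow>\<^sub>E U. F k) = (\<Sum>k\<in>J \<rightarrow>\<^sub>E U. F (restrict (k \<circ> \<pi>) I))"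
proof -
  have closed: "restrict (k \<circ> \<pi>') I' \<in> I' \<rightarrow>\<^sub>E U"
    if "bij_betw \<pi>' I' J'" "k \<in> J' \<rightarrow>\<^sub>E U" for k \<pi>' I' J'
  proof (rule PiE_I)
    fix i assume "i \<in> I'"
    then show "restrict (k \<circ> \<pi>') I' i \<in> U"
      using PiE_mem[OF that(2) bij_betw_apply[OF that(1)]] by simp
  qed simp
  have cancel: "restrict (restrict (k \<circ> \<pi>1) I' \<circ> \<pi>2) J' = k"
    if "bij_betw \<pi>2 J' I'" "\<And>i. i \<in> J' \<Longrightarrow> \<pi>1 (\<pi>2 i) = i" "k \<in> J' \<rightarrow>\<^sub>E U" for k \<pi>1 \<pi>2 I' J'
  proof
    fix i
    show "restrict (restrict (k \<circ> \<pi>1) I' \<circ> \<pi>2) J' i = k i"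
    proof (cases "i \<in> J'")
      case True
      then show ?thesis
        using that(2)[OF True] bij_betw_apply[OF that(1) True] by simp
    next
      case False
      then show ?thesis
        using PiE_arb[OF that(3) False] by simp
    qed
  qed
  note inv = bij_betw_inv_into[OF assms]
  have "bij_betw (\<lambda>k. restrict (k \<circ> \<pi>) I) (J \<rightarrow>\<^sub>E U) (I \<rightarrow>\<^sub>E U)"
  proof (rule bij_betw_byWitness[where f' = "\<lambda>k. restrict (k \<circ> inv_into I \<pi>) J"])
    show "\<forall>k\<in>J \<rightarrow>\<^sub>E U. restrict (restrict (k \<circ> \<pi>) I \<circ> inv_into I \<pi>) J = k"
      using cancel[OF inv bij_betw_inv_into_right[OF assms]] by blast
    show "\<forall>k\<in>I \<rightarrow>\<^sub>E U. restrict (restrict (k \<circ> inv_into I \<pi>) J \<circ> \<pi>) I = k"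
      using cancel[OF assms bij_betw_inv_into_left[OF assms]] by blast
  qed (use closed[OF assms] closed[OF inv] in blast)+
  from sum.reindex_bij_betw[OF this] show ?thesis
    by (rule sym)
qed

lemma pair_prod_reindex_sym:
  assumes "bij_betw \<pi> I J" "finite I" and sym: "\<And>i j. t i j = t j i"
  shows "pair_prod (\<lambda>i j. t (\<pi> i) (\<pi> j)) I = pair_prod t J"
  using assms(2,1)
proof (induction I arbitrary: J rule: finite_induct)
  case (insert a I)
  have image: "J = insert (\<pi> a) (\<pi> ` I)" and inj: "inj_on \<pi> I" and a: "\<pi> a \<notin> \<pi> ` I"
    using insert.prems insert.hyps by (auto simp: bij_betw_def)
  have J: "\<pi> a \<in> J" "finite J" "J - {\<pi> a} = \<pi> ` I"
    using image a insert.hyps by auto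
  have bij: "bij_betw \<pi> I (J - {\<pi> a})"
    using inj J(3) by (simp add: bij_betw_def)
  have diff: "insert a I - {a} = I"
    using insert.hyps by simp
  have "pair_prod (\<lambda>i j. t (\<pi> i) (\<pi> j)) (insert a I)
      = (\<Prod>i\<in>insert a I - {a}. t (\<pi> a) (\<pi> i)) * pair_prod (\<lambda>i j. t (\<pi> i) (\<pi> j)) (insert a I - {a})"
    by (rule pair_prod_remove_sym) (use insert.hyps in simp, simp, rule sym)
  also have "(\<Prod>i\<in>insert a I - {a}. t (\<pi> a) (\<pi> i)) = (\<Prod>j\<in>J - {\<pi> a}. t (\<pi> a) j)"
    unfolding diff by (rule prod.reindex_bij_betw[OF bij])
  also have "pair_prod (\<lambda>i j. t (\<pi> i) (\<pi> j)) (insert a I - {a}) = pair_prod t (J - {\<pi> a})"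
    unfolding diff by (rule insert.IH[OF bij])
  also have "(\<Prod>j\<in>J - {\<pi> a}. t (\<pi> a) j) * pair_prod t (J - {\<pi> a}) = pair_prod t J"
    by (rule pair_prod_remove_sym[symmetric]) (use J in simp, use J in simp, rule sym)
  finally show ?case .
next
  case empty
  then show ?case
    by (simp add: bij_betw_def)
qed

text \<open>
  Lagrange interpolation makes a Vandermonde product in \<open>n + 1\<close> variables a signed sum, over the
  variable \<open>i\<close> that is left out, of smaller Vandermonde products times \<open>p (y (k i))\<close>. Multiplied by
  the antisymmetric \<open>s\<close>, the pair product becomes symmetric and the signs are absorbed by the factors
  \<open>s (k j) (k i)\<close>. If two nodes agree, every term on both sides has a factor \<open>s a b = 0\<close>.
\<close>

lemma lagrange_pair_prod:
  fixes y :: "'b \<Rightarrow> real" and s :: "'b \<Rightarrow> 'b \<Rightarrow> real"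
  assumes "finite I" and card: "card I = Suc (degree p)" and lead: "lead_coeff p = 1"
    and antisym: "\<And>a b. s a b = - s b a" and tie: "\<And>a b. y a = y b \<Longrightarrow> s a b = 0"
  defines "g \<equiv> \<lambda>a b. s a b * (y b - y a)"
  shows "pair_prod (\<lambda>i j. g (k i) (k j)) I
    = (\<Sum>i\<in>I. poly p (y (k i)) * (\<Prod>j\<in>I - {i}. s (k j) (k i)) * pair_prod (\<lambda>i j. g (k i) (k j)) (I - {i}))"
proof -
  have g_sym: "g a b = g b a" for a b
    using antisym[of a b] by (simp add: g_def algebra_simps)
  have remove: "pair_prod (\<lambda>i j. g (k i) (k j)) I
      = (\<Prod>j\<in>I - {i}. g (k i) (k j)) * pair_prod (\<lambda>i j. g (k i) (k j)) (I - {i})" if "i \<in> I" for i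
    using pair_prod_remove_sym[of I i "\<lambda>i j. g (k i) (k j)"] that assms(1) g_sym by blast
  show ?thesis
  proof (cases "inj_on (\<lambda>i. y (k i)) I")
    case True
    have "(\<Sum>i\<in>I. poly p (y (k i)) / (\<Prod>j\<in>I - {i}. y (k i) - y (k j))) = 1"
    proof -
      let ?X = "(\<lambda>i. y (k i)) ` I"
      have "?X - {y (k i)} = (\<lambda>i. y (k i)) ` (I - {i})" if "i \<in> I" for i
        using True that by (auto simp: inj_on_def)
      then have "(\<Prod>z\<in>?X - {y (k i)}. y (k i) - z) = (\<Prod>j\<in>I - {i}. y (k i) - y (k j))" if "i \<in> I" for i
        using True that by (simp add: prod.reindex inj_on_diff)
      then have "(\<Sum>i\<in>I. poly p (y (k i)) / (\<Prod>j\<in>I - {i}. y (k i) - y (k j)))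
          = (\<Sum>x\<in>?X. poly p x / (\<Prod>z\<in>?X - {x}. x - z))"
        using True by (simp add: sum.reindex)
      also have "\<dots> = 1"
        using divided_difference_lead_coeff[of ?X p] True assms(1) card lead by (simp add: card_image)
      finally show ?thesis .
    qed
    then have "pair_prod (\<lambda>i j. g (k i) (k j)) I
        = (\<Sum>i\<in>I. poly p (y (k i)) / (\<Prod>j\<in>I - {i}. y (k i) - y (k j)) * pair_prod (\<lambda>i j. g (k i) (k j)) I)"
      unfolding sum_distrib_right[symmetric] by simp
    also have "\<dots> = (\<Sum>i\<in>I. poly p (y (k i)) * (\<Prod>j\<in>I - {i}. s (k j) (k i)) * pair_prod (\<lambda>i j. g (k i) (k j)) (I - {i}))"
    proof (rule sum.cong[OF refl])
      fix i assume i: "i \<in> I"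
      have "(\<Prod>j\<in>I - {i}. g (k i) (k j)) = (\<Prod>j\<in>I - {i}. s (k j) (k i)) * (\<Prod>j\<in>I - {i}. y (k i) - y (k j))"
        unfolding prod.distrib[symmetric]
      proof (rule prod.cong[OF refl])
        fix j
        show "g (k i) (k j) = s (k j) (k i) * (y (k i) - y (k j))"
          using antisym[of "k i" "k j"] by (simp add: g_def algebra_simps)
      qed
      moreover have "(\<Prod>j\<in>I - {i}. y (k i) - y (k j)) \<noteq> 0"
        using True i assms(1) by (auto simp: inj_on_def)
      ultimately show "poly p (y (k i)) / (\<Prod>j\<in>I - {i}. y (k i) - y (k j)) * pair_prod (\<lambda>i j. g (k i) (k j)) I
          = poly p (y (k i)) * (\<Prod>j\<in>I - {i}. s (k j) (k i)) * pair_prod (\<lambda>i j. g (k i) (k j)) (I - {i})"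
        unfolding remove[OF i] by simp
    qed
    finally show ?thesis .
  next
    case False
    then obtain a b where ab: "a \<in> I" "b \<in> I" "a \<noteq> b" "y (k a) = y (k b)"
      by (auto simp: inj_on_def)
    have vanish: "pair_prod (\<lambda>i j. g (k i) (k j)) J = 0" if J: "a \<in> J" "b \<in> J" "finite J" for J
    proof -
      have "(\<Prod>j\<in>J - {a}. g (k a) (k j)) = 0"
        using J ab by (intro prod_zero) (auto intro!: bexI[of _ b] simp: g_def)
      moreover have "pair_prod (\<lambda>i j. g (k i) (k j)) J
          = (\<Prod>j\<in>J - {a}. g (k a) (k j)) * pair_prod (\<lambda>i j. g (k i) (k j)) (J - {a})"
        using pair_prod_remove_sym[of J a "\<lambda>i j. g (k i) (k j)"] J g_sym by blast
      ultimately show ?thesis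
        by simp
    qed
    have "(\<Prod>j\<in>I - {i}. s (k j) (k i)) * pair_prod (\<lambda>i j. g (k i) (k j)) (I - {i}) = 0" if "i \<in> I" for i
    proof (cases "i = a \<or> i = b")
      case True
      then have "\<exists>j\<in>I - {i}. s (k j) (k i) = 0"
        using ab tie[of "k a" "k b"] tie[of "k b" "k a"] by auto
      then have "(\<Prod>j\<in>I - {i}. s (k j) (k i)) = 0"
        using assms(1) by (intro prod_zero) auto
      then show ?thesis
        by simp
    next
      case False
      then show ?thesis
        using ab assms(1) by (simp add: vanish)
    qed
    then have "(\<Sum>i\<in>I. poly p (y (k i)) *
        ((\<Prod>j\<in>I - {i}. s (k j) (k i)) * pair_prod (\<lambda>i j. g (k i) (k j)) (I - {i}))) = 0"
      by (intro sum.neutral ballI) simp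
    then show ?thesis
      using vanish[OF ab(1,2) assms(1)] by (simp only: mult.assoc)
  qed
qed

text \<open>
  The usual statement is that the Vandermonde determinant is \<open>det (p i (y (k j)))\<close> for monic \<open>p i\<close> of
  degree \<open>i\<close>, and that all \<open>r!\<close> terms of the determinant contribute equally when summed against an
  antisymmetric function. Determinants are avoided by an induction on \<open>r\<close>: the terms of the
  Lagrange expansion are exchanged by transpositions of the variables, hence have equal sums, and for
  a fixed last variable \<open>x\<close> the factors \<open>s (k i) x\<close> can be absorbed into the weight \<open>w\<close>, over which
  the induction hypothesis is quantified.
\<close>

lemma sum_pair_prod_antisymmetrize:
  fixes y :: "'b \<Rightarrow> real" and s :: "'b \<Rightarrow> 'b \<Rightarrow> real" and p :: "nat \<Rightarrow> real poly"
  assumes antisym: "\<And>a b. s a b = - s b a" and tie: "\<And>a b. y a = y b \<Longrightarrow> s a b = 0"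
    and deg: "\<And>i. degree (p i) = i" and lead: "\<And>i. lead_coeff (p i) = 1"
  shows "(\<Sum>k\<in>{..<r} \<rightarrow>\<^sub>E U. pair_prod (\<lambda>i j. s (k i) (k j) * (y (k j) - y (k i))) {..<r} * (\<Prod>i<r. w (k i)))
    = fact r * (\<Sum>k\<in>{..<r} \<rightarrow>\<^sub>E U. pair_prod (\<lambda>i j. s (k i) (k j)) {..<r} * (\<Prod>i<r. poly (p i) (y (k i)) * w (k i)))"
proof (induction r arbitrary: w)
  case (Suc r)
  let ?I = "{..<Suc r}"
  define g where "g a b = s a b * (y b - y a)" for a b
  have g_sym: "g a b = g b a" for a b
    using antisym[of a b] by (simp add: g_def algebra_simps)
  \<comment> \<open>The term of the Lagrange expansion in which the variable \<open>i\<close> is left out.\<close>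
  define H where "H i k = poly (p r) (y (k i)) * w (k i) *
    (pair_prod (\<lambda>i j. g (k i) (k j)) (?I - {i}) * (\<Prod>j\<in>?I - {i}. w (k j) * s (k j) (k i)))" for i and k :: "nat \<Rightarrow> 'b"
  have expand: "pair_prod (\<lambda>i j. g (k i) (k j)) ?I * (\<Prod>i<Suc r. w (k i)) = (\<Sum>i\<in>?I. H i k)" for k
  proof -
    have lagrange: "pair_prod (\<lambda>i j. g (k i) (k j)) ?I
      = (\<Sum>i\<in>?I. poly (p r) (y (k i)) * (\<Prod>j\<in>?I - {i}. s (k j) (k i)) * pair_prod (\<lambda>i j. g (k i) (k j)) (?I - {i}))"
      unfolding g_def by (rule lagrange_pair_prod[OF _ _ lead antisym tie]) (simp_all add: deg)
    have w: "(\<Prod>i<Suc r. w (k i)) = w (k i) * (\<Prod>j\<in>?I - {i}. w (k j))" if "i \<in> ?I" for i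
      using that by (intro prod.remove) auto
    show ?thesis
      unfolding lagrange sum_distrib_right
    proof (rule sum.cong[OF refl])
      fix i assume "i \<in> ?I"
      then show "poly (p r) (y (k i)) * (\<Prod>j\<in>?I - {i}. s (k j) (k i)) * pair_prod (\<lambda>i j. g (k i) (k j)) (?I - {i})
          * (\<Prod>i<Suc r. w (k i)) = H i k"
        unfolding H_def prod.distrib by (subst w) (simp_all only: mult_ac)
    qed
  qed
  have symmetric: "(\<Sum>k\<in>?I \<rightarrow>\<^sub>E U. H i k) = (\<Sum>k\<in>?I \<rightarrow>\<^sub>E U. H r k)" if i: "i \<in> ?I" for i
  proof -
    let ?\<pi> = "Transposition.transpose i r"
    have bij: "bij_betw ?\<pi> ?I ?I"
      using i by (intro bij_betw_transpose_iff) auto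
    have bij': "bij_betw ?\<pi> (?I - {r}) (?I - {i})"
      using bij_betw_DiffI[OF bij, of "{r}" "{i}"] i by (simp add: bij_betw_def)
    have "H r (restrict (k \<circ> ?\<pi>) ?I) = H i k" for k
    proof -
      let ?k = "restrict (k \<circ> ?\<pi>) ?I"
      have k: "?k j = k (?\<pi> j)" if "j \<in> ?I" for j
        using that by simp
      have "pair_prod (\<lambda>i j. g (?k i) (?k j)) (?I - {r})
          = pair_prod (\<lambda>i j. g (k (?\<pi> i)) (k (?\<pi> j))) (?I - {r})"
        by (rule pair_prod_cong) (use k in auto)
      also have "\<dots> = pair_prod (\<lambda>i j. g (k i) (k j)) (?I - {i})"
        by (rule pair_prod_reindex_sym[OF bij', where t = "\<lambda>i j. g (k i) (k j)"]) (use g_sym in auto)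
      finally have 1: "pair_prod (\<lambda>i j. g (?k i) (?k j)) (?I - {r}) = pair_prod (\<lambda>i j. g (k i) (k j)) (?I - {i})" .
      have 2: "?k r = k i"
        by simp
      have "(\<Prod>j\<in>?I - {r}. w (?k j) * s (?k j) (?k r)) = (\<Prod>j\<in>?I - {r}. w (k (?\<pi> j)) * s (k (?\<pi> j)) (k i))"
        by (rule prod.cong) (use k 2 in auto)
      also have "\<dots> = (\<Prod>j\<in>?I - {i}. w (k j) * s (k j) (k i))"
        by (rule prod.reindex_bij_betw[OF bij'])
      finally show ?thesis
        unfolding H_def 1 2 by simp
    qed
    then show ?thesis
      by (subst (2) sum_PiE_reindex[OF bij]) simp
  qed
  have I: "?I = insert r {..<r}" and I_r: "?I - {r} = {..<r}"
    by auto
  have "(\<Sum>k\<in>?I \<rightarrow>\<^sub>E U. pair_prod (\<lambda>i j. g (k i) (k j)) ?I * (\<Prod>i<Suc r. w (k i)))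
      = (\<Sum>i\<in>?I. \<Sum>k\<in>?I \<rightarrow>\<^sub>E U. H i k)"
    unfolding expand by (rule sum.swap)
  also have "\<dots> = (\<Sum>i\<in>?I. \<Sum>k\<in>?I \<rightarrow>\<^sub>E U. H r k)"
    by (rule sum.cong[OF refl symmetric])
  also have "\<dots> = real (Suc r) * (\<Sum>k\<in>?I \<rightarrow>\<^sub>E U. H r k)"
    by simp
  also have "(\<Sum>k\<in>?I \<rightarrow>\<^sub>E U. H r k) = (\<Sum>x\<in>U. \<Sum>k\<in>{..<r} \<rightarrow>\<^sub>E U. H r (k(r := x)))"
    unfolding I by (rule sum_PiE_insert) simp
  also have "\<dots> = (\<Sum>x\<in>U. poly (p r) (y x) * w x *
      (\<Sum>k\<in>{..<r} \<rightarrow>\<^sub>E U. pair_prod (\<lambda>i j. g (k i) (k j)) {..<r} * (\<Prod>j<r. w (k j) * s (k j) x)))"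
  proof (rule sum.cong[OF refl])
    fix x
    have "H r (k(r := x)) = poly (p r) (y x) * w x *
        (pair_prod (\<lambda>i j. g (k i) (k j)) {..<r} * (\<Prod>j<r. w (k j) * s (k j) x))" for k
    proof -
      have "pair_prod (\<lambda>i j. g ((k(r := x)) i) ((k(r := x)) j)) {..<r} = pair_prod (\<lambda>i j. g (k i) (k j)) {..<r}"
        by (rule pair_prod_fun_upd) simp
      then show ?thesis
        unfolding H_def I_r by simp
    qed
    then show "(\<Sum>k\<in>{..<r} \<rightarrow>\<^sub>E U. H r (k(r := x))) = poly (p r) (y x) * w x *
        (\<Sum>k\<in>{..<r} \<rightarrow>\<^sub>E U. pair_prod (\<lambda>i j. g (k i) (k j)) {..<r} * (\<Prod>j<r. w (k j) * s (k j) x))"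
      by (simp add: sum_distrib_left)
  qed
  also have "\<dots> = (\<Sum>x\<in>U. poly (p r) (y x) * w x * (fact r *
      (\<Sum>k\<in>{..<r} \<rightarrow>\<^sub>E U. pair_prod (\<lambda>i j. s (k i) (k j)) {..<r} *
        (\<Prod>i<r. poly (p i) (y (k i)) * (w (k i) * s (k i) x)))))"
    unfolding g_def by (rule sum.cong[OF refl]) (subst Suc.IH, rule refl)
  also have "\<dots> = fact r * (\<Sum>x\<in>U. \<Sum>k\<in>{..<r} \<rightarrow>\<^sub>E U.
      pair_prod (\<lambda>i j. s ((k(r := x)) i) ((k(r := x)) j)) ?I *
        (\<Prod>i<Suc r. poly (p i) (y ((k(r := x)) i)) * w ((k(r := x)) i)))"
  proof -
    define A where "A x k = pair_prod (\<lambda>i j. s (k i) (k j)) {..<r} *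
      (\<Prod>i<r. poly (p i) (y (k i)) * (w (k i) * s (k i) x))" for x k
    have step: "pair_prod (\<lambda>i j. s ((k(r := x)) i) ((k(r := x)) j)) ?I
        * (\<Prod>i<Suc r. poly (p i) (y ((k(r := x)) i)) * w ((k(r := x)) i))
        = poly (p r) (y x) * w x * A x k" for k x
    proof -
      let ?t = "\<lambda>i j. s ((k(r := x)) i) ((k(r := x)) j)"
      have sets: "{i \<in> ?I. i < r} = {..<r}" "{i \<in> ?I. r < i} = {}"
        by auto
      have "pair_prod ?t ?I = (\<Prod>i\<in>{i \<in> ?I. i < r}. ?t i r) * (\<Prod>i\<in>{i \<in> ?I. r < i}. ?t r i) * pair_prod ?t (?I - {r})"
        by (rule pair_prod_remove) auto
      also have "\<dots> = (\<Prod>i<r. s (k i) x) * pair_prod ?t {..<r}"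
        unfolding sets I_r by simp
      also have "pair_prod ?t {..<r} = pair_prod (\<lambda>i j. s (k i) (k j)) {..<r}"
        by (rule pair_prod_fun_upd) simp
      finally have 1: "pair_prod ?t ?I = (\<Prod>i<r. s (k i) x) * pair_prod (\<lambda>i j. s (k i) (k j)) {..<r}" .
      have 2: "(\<Prod>i<Suc r. poly (p i) (y ((k(r := x)) i)) * w ((k(r := x)) i))
          = (\<Prod>i<r. poly (p i) (y (k i)) * w (k i)) * (poly (p r) (y x) * w x)"
        by simp
      show ?thesis
        unfolding 1 2 unfolding A_def prod.distrib by (simp only: mult_ac)
    qed
    have "poly (p r) (y x) * w x * (fact r * (\<Sum>k\<in>{..<r} \<rightarrow>\<^sub>E U. A x k))
        = fact r * (\<Sum>k\<in>{..<r} \<rightarrow>\<^sub>E U. poly (p r) (y x) * w x * A x k)" for x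
      unfolding sum_distrib_left[symmetric] by (rule mult.left_commute)
    then have "(\<Sum>x\<in>U. poly (p r) (y x) * w x * (fact r * (\<Sum>k\<in>{..<r} \<rightarrow>\<^sub>E U. A x k)))
        = (\<Sum>x\<in>U. fact r * (\<Sum>k\<in>{..<r} \<rightarrow>\<^sub>E U. poly (p r) (y x) * w x * A x k))"
      by (rule sum.cong[OF refl])
    then show ?thesis
      unfolding step sum_distrib_left[symmetric, of "fact r"] unfolding A_def .
  qed
  also have "(\<Sum>x\<in>U. \<Sum>k\<in>{..<r} \<rightarrow>\<^sub>E U.
      pair_prod (\<lambda>i j. s ((k(r := x)) i) ((k(r := x)) j)) ?I *
        (\<Prod>i<Suc r. poly (p i) (y ((k(r := x)) i)) * w ((k(r := x)) i)))
      = (\<Sum>k\<in>?I \<rightarrow>\<^sub>E U. pair_prod (\<lambda>i j. s (k i) (k j)) ?I * (\<Prod>i<Suc r. poly (p i) (y (k i)) * w (k i)))"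
    unfolding I by (rule sum_PiE_insert[symmetric]) simp
  finally show ?case
    unfolding g_def fact_Suc mult.assoc .
next
  case 0
  show ?case
    unfolding lessThan_0 PiE_empty_domain pair_prod_empty prod.empty fact_0 by simp
qed

section \<open>Symmetric q-numbers\<close>

text \<open>
  The symmetric q-number \<open>(q^(x/2) - q^(-x/2)) / (q^(1/2) - q^(-1/2))\<close> for \<open>q = exp (- 2 c)\<close>.
\<close>

definition snum :: "real \<Rightarrow> real \<Rightarrow> real" where
  "snum c x = sinh (c * x) / sinh c"

lemma snum_0 [simp]: "snum c 0 = 0"
  by (simp add: snum_def)

lemma snum_minus [simp]: "snum c (- x) = - snum c x"
  by (simp add: snum_def)

lemma snum_pos: "c > 0 \<Longrightarrow> x > 0 \<Longrightarrow> snum c x > 0"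
  by (simp add: snum_def)

lemma snum_nonzero: "c > 0 \<Longrightarrow> x > 0 \<Longrightarrow> snum c x \<noteq> 0"
  using snum_pos[of c x] by simp

lemma sgn_snum: "c > 0 \<Longrightarrow> sgn (snum c x) = sgn x"
  by (cases x "0 :: real" rule: linorder_cases) (auto simp: snum_pos snum_def divide_neg_pos mult_pos_neg)

lemma snum_product_diff:
  "snum c (a + k) * snum c (b + k) - snum c (a - k) * snum c (b - k) = snum c (2 * k) * snum c (a + b)"
proof -
  have "sinh (A + K) * sinh (B + K) - sinh (A - K) * sinh (B - K) = sinh (2 * K) * sinh (A + B)" for A B K :: real
    unfolding sinh_double sinh_add sinh_diff by (simp add: algebra_simps)
  from this[of "c * a" "c * k" "c * b"] show ?thesis
    unfolding snum_def by (simp add: field_simps add_divide_distrib diff_divide_distrib)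
qed

lemma snum_cross_diff:
  "snum c (b + k) * snum c (a - k) - snum c (a + k) * snum c (b - k) = snum c (2 * k) * snum c (a - b)"
proof -
  have "sinh (B + K) * sinh (A - K) - sinh (A + K) * sinh (B - K) = sinh (2 * K) * sinh (A - B)" for A B K :: real
    unfolding sinh_double sinh_add sinh_diff by (simp add: algebra_simps)
  from this[of "c * b" "c * k" "c * a"] show ?thesis
    unfolding snum_def by (simp add: field_simps add_divide_distrib diff_divide_distrib)
qed

lemma snum_telescope:
  "snum c m * (snum c (m + k) - snum c (m - k)) = snum c (2 * m) * snum c k"
proof -
  have "sinh M * (sinh (M + K) - sinh (M - K)) = sinh (2 * M) * sinh K" for M K :: real
    unfolding sinh_double sinh_add sinh_diff by (simp add: algebra_simps)
  from this[of "c * m" "c * k"] show ?thesis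
    unfolding snum_def by (simp add: field_simps add_divide_distrib diff_divide_distrib)
qed

text \<open>
  \<open>(q^x + q^(-x)) / (q^(1/2) - q^(-1/2))^2\<close>, the variable in which the type B Vandermonde product is
  an ordinary one.
\<close>

definition cosh_node :: "real \<Rightarrow> real \<Rightarrow> real" where
  "cosh_node c x = cosh (2 * (c * x)) / (2 * sinh c ^ 2)"

lemma cosh_node_diff: "cosh_node c a - cosh_node c b = snum c (a - b) * snum c (a + b)"
proof -
  have "cosh (2 * A) - cosh (2 * B) = 2 * (sinh (A - B) * sinh (A + B))" for A B :: real
  proof -
    have "cosh (2 * A) = cosh (A + B) * cosh (A - B) + sinh (A + B) * sinh (A - B)"
      by (simp flip: cosh_add)
    moreover have "cosh (2 * B) = cosh (A + B) * cosh (A - B) - sinh (A + B) * sinh (A - B)"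
      by (simp flip: cosh_diff)
    ultimately show ?thesis
      by simp
  qed
  from this[of "c * a" "c * b"] show ?thesis
    unfolding snum_def cosh_node_def by (simp add: power2_eq_square algebra_simps flip: diff_divide_distrib)
qed

definition sfact :: "real \<Rightarrow> nat \<Rightarrow> real" where
  "sfact c L = (\<Prod>i=1..L. snum c (real i))"

text \<open>
  The Gaussian binomial coefficient, made invariant under \<open>q \<mapsto> 1 / q\<close> by a power of \<open>q\<close>. The value
  \<open>0\<close> outside the range makes the contiguous relations below valid for all integers \<open>j\<close>, and it makes
  the tails of the sums vanish at the end of the range.
\<close>

definition sbinom :: "real \<Rightarrow> nat \<Rightarrow> int \<Rightarrow> real" where
  "sbinom c L j = (if 0 \<le> j \<and> j \<le> int L then sfact c L / (sfact c (nat j) * sfact c (nat (int L - j))) else 0)"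

lemma sfact_Suc: "sfact c (Suc L) = snum c (real (Suc L)) * sfact c L"
  by (simp add: sfact_def prod.nat_ivl_Suc')

lemma sfact_pos: "c > 0 \<Longrightarrow> sfact c L > 0"
  unfolding sfact_def by (rule prod_pos) (auto intro: snum_pos)

lemma sbinom_lower:
  assumes "c > 0"
  shows "sbinom c (Suc L) j * snum c (real_of_int j) = snum c (real (Suc L)) * sbinom c L (j - 1)"
proof -
  consider "j = 0" | "j < 0 \<or> j > int (Suc L)" | "1 \<le> j" "j \<le> int (Suc L)"
    by linarith
  then show ?thesis
  proof cases
    case 3
    define a where "a = nat (j - 1)"
    have j: "j = int (Suc a)" and "a \<le> L"
      using 3 by (auto simp: a_def)
    have "sfact c (nat j) = snum c (real_of_int j) * sfact c a" "nat (int (Suc L) - j) = nat (int L - (j - 1))"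
      unfolding j by (auto simp: nat_int sfact_Suc simp del: of_nat_Suc)
    moreover have "snum c (real_of_int j) \<noteq> 0"
      using assms 3 by (intro snum_nonzero) auto
    ultimately show ?thesis
      using 3 by (simp add: sbinom_def sfact_Suc a_def)
  qed (auto simp: sbinom_def)
qed

lemma sbinom_symmetric: "sbinom c L (int L - j) = sbinom c L j"
  by (auto simp: sbinom_def mult.commute)

lemma sbinom_upper:
  assumes "c > 0"
  shows "sbinom c (Suc L) j * snum c (real (Suc L) - real_of_int j) = snum c (real (Suc L)) * sbinom c L j"
proof -
  have "real (Suc L) - real_of_int j = real_of_int (int (Suc L) - j)"
    by simp
  then have "sbinom c (Suc L) j * snum c (real (Suc L) - real_of_int j)
      = snum c (real (Suc L)) * sbinom c L (int (Suc L) - j - 1)"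
    using sbinom_lower[OF assms, of L "int (Suc L) - j"] by (simp only: sbinom_symmetric)
  also have "int (Suc L) - j - 1 = int L - j"
    by simp
  finally show ?thesis
    by (simp only: sbinom_symmetric)
qed

lemma sbinom_lower_upper:
  assumes "c > 0"
  shows "sbinom c (Suc (Suc L)) j * (snum c (real_of_int j) * snum c (real (Suc (Suc L)) - real_of_int j))
    = snum c (real (Suc (Suc L))) * snum c (real (Suc L)) * sbinom c L (j - 1)"
proof -
  have "real (Suc (Suc L)) - real_of_int j = real (Suc L) - real_of_int (j - 1)"
    by simp
  then show ?thesis
    using sbinom_lower[OF assms, of "Suc L" j] sbinom_upper[OF assms, of L "j - 1"]
    by (metis mult.assoc)
qed

section \<open>The sums over one and two variables\<close>

text \<open>
  Summing over \<open>d\<close> first replaces the difference of \<open>u\<close> by \<open>u e + u (e + 1) - u 0\<close>. The product with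
  \<open>v e - v (e + 1)\<close> is a difference of \<open>u v\<close> plus the cross term of the hypothesis, which is
  \<open>\<rho>\<close> times a difference of \<open>u v\<close> as well.
\<close>

lemma sum_telescope_sgn:
  fixes u v :: "nat \<Rightarrow> real"
  assumes end_zero: "u D = 0" "v D = 0"
    and rho: "\<And>d. d < D \<Longrightarrow> v d * u (Suc d) - u d * v (Suc d) = \<rho> * (u d * v d - u (Suc d) * v (Suc d))"
  shows "(\<Sum>d<D. \<Sum>e<D. (u d - u (Suc d)) * (v e - v (Suc e)) * sgn (real d - real e)) = u 0 * v 0 * \<rho>"
proof -
  have inner: "(\<Sum>d<D. (u d - u (Suc d)) * sgn (real d - real e)) = u e + u (Suc e) - u 0" if "e < D" for e
  proof -
    have "(\<Sum>d<D. (u d - u (Suc d)) * sgn (real d - real e))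
        = (\<Sum>d\<in>{..<e} \<union> {Suc e..<D}. (u d - u (Suc d)) * sgn (real d - real e))"
    proof (rule sum.mono_neutral_right)
      show "\<forall>d\<in>{..<D} - ({..<e} \<union> {Suc e..<D}). (u d - u (Suc d)) * sgn (real d - real e) = 0"
      proof
        fix d assume "d \<in> {..<D} - ({..<e} \<union> {Suc e..<D})"
        then have "d = e"
          by auto
        then show "(u d - u (Suc d)) * sgn (real d - real e) = 0"
          by simp
      qed
    qed (use that in auto)
    also have "\<dots> = (\<Sum>d<e. (u d - u (Suc d)) * sgn (real d - real e)) + (\<Sum>d=Suc e..<D. (u d - u (Suc d)) * sgn (real d - real e))"
      by (rule sum.union_disjoint) auto
    also have "(\<Sum>d<e. (u d - u (Suc d)) * sgn (real d - real e)) = (\<Sum>d<e. u (Suc d) - u d)"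
      by (rule sum.cong) auto
    also have "\<dots> = u e - u 0"
      by (rule sum_lessThan_telescope)
    also have "(\<Sum>d=Suc e..<D. (u d - u (Suc d)) * sgn (real d - real e)) = - (\<Sum>d=Suc e..<D. u (Suc d) - u d)"
      unfolding sum_negf[symmetric] by (rule sum.cong) auto
    also have "(\<Sum>d=Suc e..<D. u (Suc d) - u d) = u D - u (Suc e)"
      using that by (intro sum_Suc_diff') simp
    finally show ?thesis
      using end_zero by simp
  qed
  have "(\<Sum>d<D. \<Sum>e<D. (u d - u (Suc d)) * (v e - v (Suc e)) * sgn (real d - real e))
      = (\<Sum>e<D. (v e - v (Suc e)) * (\<Sum>d<D. (u d - u (Suc d)) * sgn (real d - real e)))"
    by (subst sum.swap) (simp add: sum_distrib_left mult_ac)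
  also have "\<dots> = (\<Sum>e<D. (v e - v (Suc e)) * (u e + u (Suc e) - u 0))"
    by (rule sum.cong) (simp_all add: inner)
  \<comment> \<open>The cross term of \<open>u\<close> and \<open>v\<close> is replaced using \<open>rho\<close>; both summands are now differences.\<close>
  also have "\<dots> = (\<Sum>e<D. - (1 + \<rho>) * (u (Suc e) * v (Suc e) - u e * v e) + u 0 * (v (Suc e) - v e))"
  proof (rule sum.cong[OF refl])
    fix e assume "e \<in> {..<D}"
    then show "(v e - v (Suc e)) * (u e + u (Suc e) - u 0)
        = - (1 + \<rho>) * (u (Suc e) * v (Suc e) - u e * v e) + u 0 * (v (Suc e) - v e)"
      using rho[of e] by (simp add: algebra_simps)
  qed
  also have "\<dots> = - (1 + \<rho>) * (u D * v D - u 0 * v 0) + u 0 * (v D - v 0)"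
    unfolding sum.distrib sum_distrib_left[symmetric]
    using sum_lessThan_telescope[of "\<lambda>e. u e * v e" D] sum_lessThan_telescope[of v D] by simp
  finally show ?thesis
    using end_zero by (simp add: algebra_simps)
qed

lemma unit_steps_half: "unit_steps (real N / 2) = (\<lambda>j. real j - real N / 2) ` {..N}"
proof (intro equalityI subsetI)
  fix k assume k: "k \<in> unit_steps (real N / 2)"
  then obtain j :: int where j: "real N / 2 + k = real_of_int j"
    by (auto simp: unit_steps_def elim: Ints_cases)
  have "0 \<le> real_of_int j" "real_of_int j \<le> real N"
    using k by (auto simp: unit_steps_def simp flip: j)
  then have "nat j \<in> {..N}" "k = real (nat j) - real N / 2"
    using j by auto
  then show "k \<in> (\<lambda>j. real j - real N / 2) ` {..N}"
    by blast
qed (auto simp: unit_steps_def)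

text \<open>
  The positive elements of the range are \<open>1, 2, \<dots>\<close> for even \<open>N\<close> and \<open>1/2, 3/2, \<dots>\<close> for odd \<open>N\<close>; there
  are \<open>N - N div 2\<close> of them.
\<close>

lemma sum_unit_steps_even:
  fixes f :: "real \<Rightarrow> real"
  assumes even: "\<And>k. k \<in> unit_steps (real N / 2) \<Longrightarrow> f (- k) = f k" and "f 0 = 0"
  shows "(\<Sum>k\<in>unit_steps (real N / 2). f k)
    = 2 * (\<Sum>d<N - N div 2. f (real (Suc (N div 2 + d)) - real N / 2))"
proof -
  let ?f = "\<lambda>j. f (real j - real N / 2)"
  define D j0 where "D = N - N div 2" and "j0 = Suc (N div 2)"
  have "(\<Sum>k\<in>unit_steps (real N / 2). f k) = (\<Sum>j\<le>N. ?f j)"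
    unfolding unit_steps_half by (subst sum.reindex) (auto simp: inj_on_def)
  also have "{..N} = ({..<D} \<union> {D..<j0}) \<union> {j0..<j0 + D}"
    by (auto simp: D_def j0_def)
  also have "(\<Sum>j\<in>\<dots>. ?f j) = (\<Sum>j\<in>{..<D} \<union> {D..<j0}. ?f j) + (\<Sum>j=j0..<j0 + D. ?f j)"
    by (rule sum.union_disjoint) (auto simp: D_def j0_def)
  also have "(\<Sum>j\<in>{..<D} \<union> {D..<j0}. ?f j) = (\<Sum>j<D. ?f j) + (\<Sum>j=D..<j0. ?f j)"
    by (rule sum.union_disjoint) auto
  also have "(\<Sum>j=D..<j0. ?f j) = 0"
  proof (rule sum.neutral, rule ballI)
    fix j assume "j \<in> {D..<j0}"
    then have "2 * j = N"
      unfolding D_def j0_def by auto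
    then have "real j - real N / 2 = 0"
      by auto
    then show "?f j = 0"
      using \<open>f 0 = 0\<close> by (simp only:)
  qed
  also have "(\<Sum>j=j0..<j0 + D. ?f j) = (\<Sum>d<D. ?f (j0 + d))"
    using sum.shift_bounds_nat_ivl[of ?f 0 j0 D] by (simp add: atLeast0LessThan add.commute)
  also have "(\<Sum>j<D. ?f j) = (\<Sum>d<D. ?f (j0 + d))"
  proof -
    have "(\<Sum>j<D. ?f j) = (\<Sum>d<D. ?f (D - Suc d))"
      by (rule sum.nat_diff_reindex[symmetric])
    also have "\<dots> = (\<Sum>d<D. ?f (j0 + d))"
    proof (rule sum.cong[OF refl])
      fix d assume "d \<in> {..<D}"
      then have "real (D - Suc d) - real N / 2 = - (real (j0 + d) - real N / 2)"
        and "j0 + d \<in> {..N}"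
        unfolding D_def j0_def by (auto simp: of_nat_diff)
      moreover from this(2) have "real (j0 + d) - real N / 2 \<in> unit_steps (real N / 2)"
        unfolding unit_steps_half by (rule imageI)
      ultimately show "?f (D - Suc d) = ?f (j0 + d)"
        by (simp only: even)
    qed
    finally show ?thesis .
  qed
  finally show ?thesis
    by (simp add: D_def j0_def)
qed

text \<open>
  The coefficient with top entry \<open>2 m\<close> and bottom entry \<open>m + k\<close>, where \<open>m = N / 2 - i\<close>.
\<close>

definition weight :: "real \<Rightarrow> nat \<Rightarrow> nat \<Rightarrow> real \<Rightarrow> real" where
  "weight c N i k = sbinom c (N - 2 * i) (\<lfloor>k + real N / 2\<rfloor> - int i)"

text \<open>
  The sum of \<open>snum c k * weight c N i k\<close> over the positive \<open>k\<close> from the one with number \<open>d\<close> (counted from \<open>0\<close>) onwards; that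
  it has this closed form is \<open>tail_diff\<close> together with \<open>tail_end\<close>.
\<close>

definition tail :: "real \<Rightarrow> nat \<Rightarrow> nat \<Rightarrow> nat \<Rightarrow> real" where
  "tail c N i d = snum c (real N / 2 - real i) * sbinom c (N - 2 * i - 1) (int (N div 2 + d) - int i)"

lemma tail_eq_weight:
  assumes "c > 0" "2 * i < N"
  defines "m \<equiv> real N / 2 - real i" and "k \<equiv> \<lambda>d. real (Suc (N div 2 + d)) - real N / 2"
  shows "tail c N i d = snum c m * weight c N i (k d) / snum c (2 * m) * snum c (m + k d)"
    and "tail c N i (Suc d) = snum c m * weight c N i (k d) / snum c (2 * m) * snum c (m - k d)"
proof -
  obtain L where L: "N - 2 * i = Suc L"
    using assms(2) by (metis Suc_diff_Suc)
  define j where "j = int (Suc (N div 2 + d)) - int i"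
  have two_m: "2 * m = real (Suc L)"
    unfolding m_def L[symmetric] using assms(2) by (simp add: of_nat_diff)
  have nz: "snum c (2 * m) \<noteq> 0"
    by (rule snum_nonzero) (use assms two_m in auto)
  have m_plus: "m + k d = real_of_int j" and m_minus: "m - k d = real (Suc L) - real_of_int j"
    unfolding two_m[symmetric] by (simp_all add: m_def k_def j_def)
  have "k d + real N / 2 = real_of_int (int (Suc (N div 2 + d)))"
    by (simp add: k_def)
  then have "\<lfloor>k d + real N / 2\<rfloor> = int (Suc (N div 2 + d))"
    by (simp only: floor_of_int)
  then have w: "weight c N i (k d) = sbinom c (Suc L) j"
    by (simp only: weight_def L j_def)
  have t: "tail c N i d = snum c m * sbinom c L (j - 1)"
    "tail c N i (Suc d) = snum c m * sbinom c L j"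
    unfolding tail_def L m_def j_def by (simp_all add: algebra_simps)
  show "tail c N i d = snum c m * weight c N i (k d) / snum c (2 * m) * snum c (m + k d)"
    using sbinom_lower[OF assms(1), of L j] nz unfolding t w m_plus two_m by (simp add: field_simps)
  show "tail c N i (Suc d) = snum c m * weight c N i (k d) / snum c (2 * m) * snum c (m - k d)"
    using sbinom_upper[OF assms(1), of L j] nz unfolding t w m_minus two_m by (simp add: field_simps)
qed

lemma tail_diff:
  assumes "c > 0" "2 * i < N"
  defines "k \<equiv> \<lambda>d. real (Suc (N div 2 + d)) - real N / 2"
  shows "tail c N i d - tail c N i (Suc d) = snum c (k d) * weight c N i (k d)"
proof -
  let ?m = "real N / 2 - real i"
  have nz: "snum c (2 * ?m) \<noteq> 0"
    by (rule snum_nonzero) (use assms in auto)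
  have "tail c N i d - tail c N i (Suc d)
      = weight c N i (k d) / snum c (2 * ?m) * (snum c ?m * (snum c (?m + k d) - snum c (?m - k d)))"
    using tail_eq_weight[OF assms(1,2), of d] unfolding k_def by (simp add: algebra_simps)
  also have "\<dots> = snum c (k d) * weight c N i (k d)"
    unfolding snum_telescope using nz by simp
  finally show ?thesis .
qed

lemma tail_end:
  assumes "2 * i < N"
  shows "tail c N i (N - N div 2) = 0"
  using assms by (simp add: tail_def sbinom_def)

text \<open>
  Both sides are the product of the two weights times differences of products of q-numbers
  \<open>snum (m \<plusminus> k)\<close>, and these differences share the factor \<open>snum (2 k)\<close>.
\<close>

lemma tail_rho:
  assumes "c > 0" "2 * i < N" "2 * j < N"
  shows "tail c N j d * tail c N i (Suc d) - tail c N i d * tail c N j (Suc d)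
    = snum c (real j - real i) / snum c (real N - real i - real j)
      * (tail c N i d * tail c N j d - tail c N i (Suc d) * tail c N j (Suc d))"
proof -
  let ?m = "\<lambda>i. real N / 2 - real i" and ?k = "real (Suc (N div 2 + d)) - real N / 2"
  define A where "A i = snum c (?m i) * weight c N i ?k / snum c (2 * ?m i)" for i
  have t: "tail c N i d = A i * snum c (?m i + ?k)" "tail c N i (Suc d) = A i * snum c (?m i - ?k)"
    if "2 * i < N" for i
    using tail_eq_weight[OF assms(1) that, of d] by (simp_all add: A_def)
  have sum_m: "?m i + ?m j = real N - real i - real j" and diff_m: "?m i - ?m j = real j - real i"
    by (simp_all add: field_simps)
  have nz: "snum c (real N - real i - real j) \<noteq> 0"
    by (rule snum_nonzero) (use assms in auto)
  have "tail c N j d * tail c N i (Suc d) - tail c N i d * tail c N j (Suc d)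
      = A i * A j * (snum c (?m j + ?k) * snum c (?m i - ?k) - snum c (?m i + ?k) * snum c (?m j - ?k))"
    unfolding t[OF assms(2)] t[OF assms(3)] by (simp only: right_diff_distrib mult_ac)
  also have "\<dots> = A i * A j * (snum c (2 * ?k) * snum c (real j - real i))"
    unfolding snum_cross_diff diff_m ..
  also have "\<dots> = snum c (real j - real i) / snum c (real N - real i - real j)
      * (A i * A j * (snum c (2 * ?k) * snum c (real N - real i - real j)))"
    using nz by simp
  also have "A i * A j * (snum c (2 * ?k) * snum c (real N - real i - real j))
      = A i * A j * (snum c (?m i + ?k) * snum c (?m j + ?k) - snum c (?m i - ?k) * snum c (?m j - ?k))"
    unfolding snum_product_diff sum_m ..
  also have "\<dots> = tail c N i d * tail c N j d - tail c N i (Suc d) * tail c N j (Suc d)"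
    unfolding t[OF assms(2)] t[OF assms(3)] by (simp only: right_diff_distrib mult_ac)
  finally show ?thesis .
qed

lemma weight_even:
  assumes "2 * i < N" "k \<in> unit_steps (real N / 2)"
  shows "weight c N i (- k) = weight c N i k"
proof -
  obtain j where j: "k = real j - real N / 2" "j \<le> N"
    using assms(2) unfolding unit_steps_half by auto
  have "k + real N / 2 = of_int (int j)" "- k + real N / 2 = of_int (int N - int j)"
    using j by simp_all
  then have "\<lfloor>k + real N / 2\<rfloor> = int j" "\<lfloor>- k + real N / 2\<rfloor> = int N - int j"
    by (simp_all only: floor_of_int)
  moreover have "int N - int j - int i = int (N - 2 * i) - (int j - int i)"
    using assms(1) by simp
  ultimately show ?thesis
    unfolding weight_def by (simp only: sbinom_symmetric)
qed

lemma half_less_node: "real N < 2 * real (Suc (N div 2 + d))"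
proof -
  have "N < 2 * Suc (N div 2 + d)"
    by simp
  then have "real N < real (2 * Suc (N div 2 + d))"
    by (simp only: of_nat_less_iff)
  then show ?thesis
    by simp
qed

lemma sum_weight_single:
  assumes "c > 0" "2 * i < N"
  shows "(\<Sum>k\<in>unit_steps (real N / 2). \<bar>snum c k\<bar> * weight c N i k) = 2 * tail c N i 0"
proof -
  let ?k = "\<lambda>d. real (Suc (N div 2 + d)) - real N / 2"
  have "(\<Sum>k\<in>unit_steps (real N / 2). \<bar>snum c k\<bar> * weight c N i k)
      = 2 * (\<Sum>d<N - N div 2. \<bar>snum c (?k d)\<bar> * weight c N i (?k d))"
    by (rule sum_unit_steps_even) (simp_all add: weight_even assms)
  also have "(\<Sum>d<N - N div 2. \<bar>snum c (?k d)\<bar> * weight c N i (?k d))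
      = (\<Sum>d<N - N div 2. tail c N i d - tail c N i (Suc d))"
  proof (rule sum.cong[OF refl])
    fix d
    have "real N < 2 * real (Suc (N div 2 + d))"
      by (rule half_less_node)
    then have "snum c (?k d) > 0"
      using assms(1) by (intro snum_pos) auto
    then show "\<bar>snum c (?k d)\<bar> * weight c N i (?k d) = tail c N i d - tail c N i (Suc d)"
      unfolding tail_diff[OF assms] by simp
  qed
  also have "\<dots> = tail c N i 0"
    unfolding sum_lessThan_telescope' tail_end[OF assms(2)] by simp
  finally show ?thesis .
qed

text \<open>
  Everything is even in both variables, so this is four times the sum over the positive halves, where
  the weights are the differences of the two tails.
\<close>

lemma sum_weight_double:
  assumes "c > 0" "2 * i < N" "2 * j < N"
  shows "(\<Sum>k\<in>unit_steps (real N / 2). \<Sum>l\<in>unit_steps (real N / 2).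
      \<bar>snum c k\<bar> * weight c N i k * (\<bar>snum c l\<bar> * weight c N j l) * sgn (\<bar>k\<bar> - \<bar>l\<bar>))
    = 2 * tail c N i 0 * (2 * tail c N j 0) * (snum c (real j - real i) / snum c (real N - real i - real j))"
proof -
  let ?U = "unit_steps (real N / 2)" and ?k = "\<lambda>d. real (Suc (N div 2 + d)) - real N / 2"
  let ?\<phi> = "\<lambda>i k. \<bar>snum c k\<bar> * weight c N i k"
  have \<phi>: "?\<phi> i (?k d) = tail c N i d - tail c N i (Suc d)" if "2 * i < N" for i d
  proof -
    have "real N < 2 * real (Suc (N div 2 + d))"
      by (rule half_less_node)
    then have "snum c (?k d) > 0"
      using assms(1) by (intro snum_pos) auto
    then show ?thesis
      unfolding tail_diff[OF assms(1) that] by simp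
  qed
  have abs_k: "\<bar>?k d\<bar> - \<bar>?k e\<bar> = real d - real e" for d e
  proof -
    have "real N < 2 * real (Suc (N div 2 + d))" "real N < 2 * real (Suc (N div 2 + e))"
      by (rule half_less_node)+
    then show ?thesis
      by simp
  qed
  have "(\<Sum>l\<in>?U. ?\<phi> i k * ?\<phi> j l * sgn (\<bar>k\<bar> - \<bar>l\<bar>))
      = 2 * (\<Sum>e<N - N div 2. ?\<phi> i k * ?\<phi> j (?k e) * sgn (\<bar>k\<bar> - \<bar>?k e\<bar>))" for k
    by (rule sum_unit_steps_even) (simp_all add: weight_even assms)
  then have "(\<Sum>k\<in>?U. \<Sum>l\<in>?U. ?\<phi> i k * ?\<phi> j l * sgn (\<bar>k\<bar> - \<bar>l\<bar>))
      = (\<Sum>k\<in>?U. 2 * (\<Sum>e<N - N div 2. ?\<phi> i k * ?\<phi> j (?k e) * sgn (\<bar>k\<bar> - \<bar>?k e\<bar>)))"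
    by simp
  also have "\<dots> = 2 * (\<Sum>d<N - N div 2. 2 * (\<Sum>e<N - N div 2. ?\<phi> i (?k d) * ?\<phi> j (?k e) * sgn (\<bar>?k d\<bar> - \<bar>?k e\<bar>)))"
    by (rule sum_unit_steps_even) (simp_all add: weight_even assms)
  also have "\<dots> = 4 * (\<Sum>d<N - N div 2. \<Sum>e<N - N div 2.
      (tail c N i d - tail c N i (Suc d)) * (tail c N j e - tail c N j (Suc e)) * sgn (real d - real e))"
    unfolding \<phi>[OF assms(2)] \<phi>[OF assms(3)] abs_k by (simp flip: sum_distrib_left)
  also have "\<dots> = 4 * (tail c N i 0 * tail c N j 0 * (snum c (real j - real i) / snum c (real N - real i - real j)))"
    by (subst sum_telescope_sgn[OF tail_end tail_end tail_rho]) (use assms in auto)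
  finally show ?thesis
    by simp
qed

text \<open>
  \<open>sinh (a - b) / sinh (a + b) = (tanh a - tanh b) / (tanh a + tanh b)\<close>.
\<close>

lemma pfaffian_kernel_snum:
  assumes "c > 0" "finite I" and bound: "\<And>i. i \<in> I \<Longrightarrow> 2 * i < N"
  shows "pfaffian_kernel (\<lambda>i j. snum c (real j - real i) / snum c (real N - real i - real j)) I"
proof -
  let ?m = "\<lambda>i. c * (real N / 2 - real i)"
  have pos: "?m i > 0" if "i \<in> I" for i
    using bound[OF that] assms(1) by simp
  have "(tanh a - tanh b) / (tanh a + tanh b) = sinh (a - b) / sinh (a + b)" for a b :: real
  proof -
    have "cosh a > 0" "cosh b > 0"
      by simp_all
    then have "tanh a - tanh b = sinh (a - b) / (cosh a * cosh b)" "tanh a + tanh b = sinh (a + b) / (cosh a * cosh b)"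
      by (simp_all add: tanh_def sinh_diff sinh_add field_simps)
    then show ?thesis
      using \<open>cosh a > 0\<close> \<open>cosh b > 0\<close> by simp
  qed
  then have "(tanh (?m i) - tanh (?m j)) / (tanh (?m i) + tanh (?m j))
      = snum c (real j - real i) / snum c (real N - real i - real j)" for i j
    using assms(1) by (simp add: snum_def algebra_simps)
  moreover have "pfaffian_kernel (\<lambda>i j. (tanh (?m i) - tanh (?m j)) / (tanh (?m i) + tanh (?m j))) I"
  proof (rule pfaffian_kernel_schur[OF assms(2)])
    show "inj_on (\<lambda>i. tanh (?m i)) I"
      using assms(1) by (auto simp: inj_on_def)
    show "tanh (?m i) + tanh (?m j) \<noteq> 0" if "i \<in> I" "j \<in> I" for i j
      using pos[OF that(1)] pos[OF that(2)] by (metis add_pos_pos less_irrefl tanh_real_pos_iff)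
  qed
  ultimately show ?thesis
    by simp
qed

lemma sum_sgn_weights:
  assumes "c > 0" "2 * r \<le> N + 1"
  shows "(\<Sum>k\<in>{..<r} \<rightarrow>\<^sub>E unit_steps (real N / 2).
      pair_prod (\<lambda>i j. sgn (\<bar>k i\<bar> - \<bar>k j\<bar>)) {..<r} * (\<Prod>i<r. \<bar>snum c (k i)\<bar> * weight c N i (k i)))
    = (\<Prod>i<r. 2 * tail c N i 0)
      * pair_prod (\<lambda>i j. snum c (real j - real i) / snum c (real N - real i - real j)) {..<r}"
proof (rule sum_pair_prod_kernel)
  show "pfaffian_kernel (\<lambda>i j. sgn (\<bar>k i\<bar> - \<bar>k j\<bar>)) {..<r}" for k :: "nat \<Rightarrow> real"
    by (rule pfaffian_kernel_sgn) simp
  have bound: "2 * i < N" if "i \<in> {..<r}" for i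
    using that assms(2) by simp
  show "pfaffian_kernel (\<lambda>i j. snum c (real j - real i) / snum c (real N - real i - real j)) {..<r}"
    by (rule pfaffian_kernel_snum[OF assms(1) _ bound]) simp_all
  show "(\<Sum>k\<in>unit_steps (real N / 2). \<bar>snum c k\<bar> * weight c N i k) = 2 * tail c N i 0" if "i \<in> {..<r}" for i
    by (rule sum_weight_single[OF assms(1) bound[OF that]])
  show "(\<Sum>k\<in>unit_steps (real N / 2). \<Sum>l\<in>unit_steps (real N / 2).
      \<bar>snum c k\<bar> * weight c N i k * (\<bar>snum c l\<bar> * weight c N j l) * sgn (\<bar>k\<bar> - \<bar>l\<bar>))
    = 2 * tail c N i 0 * (2 * tail c N j 0) * (snum c (real j - real i) / snum c (real N - real i - real j))"
    if "i \<in> {..<r}" "j \<in> {..<r}" for i j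
    by (rule sum_weight_double[OF assms(1) bound[OF that(1)] bound[OF that(2)]])
qed simp

text \<open>
  Each factor is \<open>snum (m - k) snum (m + k)\<close> with \<open>m = N / 2 - a\<close>, and multiplication by it lowers the
  top entry \<open>2 m\<close> of the binomial coefficient by two and its bottom entry by one.
\<close>

lemma weight_zero_eq:
  assumes "c > 0" "2 * i < N" and k: "k \<in> unit_steps (real N / 2)"
  shows "weight c N 0 k * (\<Prod>a<i. cosh_node c (real N / 2 - real a) - cosh_node c k)
    = (\<Prod>a<i. snum c (real (N - 2 * a)) * snum c (real (N - 2 * a - 1))) * weight c N i k"
  using assms(2)
proof (induction i)
  case (Suc i)
  define L where "L = N - 2 * i - 2"
  have L: "N - 2 * i = Suc (Suc L)"
    using Suc.prems unfolding L_def by simp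
  obtain p where p: "k = real p - real N / 2" "p \<le> N"
    using k unfolding unit_steps_half by auto
  define j where "j = int p - int i"
  have "k + real N / 2 = real_of_int (int p)"
    using p by simp
  then have fl: "\<lfloor>k + real N / 2\<rfloor> = int p"
    by (simp only: floor_of_int)
  have L': "N - 2 * Suc i = L"
    using L by simp
  have w: "weight c N i k = sbinom c (Suc (Suc L)) j" "weight c N (Suc i) k = sbinom c L (j - 1)"
    unfolding weight_def fl L L' j_def by (simp_all add: algebra_simps)
  have real_L: "real (Suc (Suc L)) = real N - 2 * real i"
    unfolding L[symmetric] using Suc.prems by (simp add: of_nat_diff)
  have "real N / 2 - real i - k = real (Suc (Suc L)) - real_of_int j"
    "real N / 2 - real i + k = real_of_int j"
    unfolding real_L by (simp_all add: j_def p)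
  then have step: "weight c N i k * (cosh_node c (real N / 2 - real i) - cosh_node c k)
      = snum c (real (N - 2 * i)) * snum c (real (N - 2 * i - 1)) * weight c N (Suc i) k"
    unfolding cosh_node_diff w L using sbinom_lower_upper[OF assms(1), of L j] by (simp add: mult.commute)
  have IH: "weight c N 0 k * (\<Prod>a<i. cosh_node c (real N / 2 - real a) - cosh_node c k)
      = (\<Prod>a<i. snum c (real (N - 2 * a)) * snum c (real (N - 2 * a - 1))) * weight c N i k"
    by (rule Suc.IH) (use Suc.prems in simp)
  show ?case
    unfolding prod.lessThan_Suc mult.assoc[symmetric] IH unfolding mult.assoc step ..
qed simp

section \<open>The sum in symmetric form\<close>

lemma pair_prod_lessThan: "pair_prod t {..<r} = (\<Prod>j<r. \<Prod>i<j. t i j)"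
proof -
  have "(\<Prod>j<r. \<Prod>i<j. t i j) = (\<Prod>(j, i)\<in>(SIGMA j:{..<r}. {..<j}). t i j)"
    by (rule prod.Sigma) auto
  also have "\<dots> = pair_prod t {..<r}"
    unfolding pair_prod_def
    by (rule prod.reindex_bij_witness[of _ "\<lambda>(i, j). (j, i)" "\<lambda>(j, i). (i, j)"]) auto
  finally show ?thesis
    by (rule sym)
qed

lemma pair_prod_atLeastAtMost: "pair_prod t {1..r} = (\<Prod>i\<in>{1..r}. \<Prod>j\<in>{i<..r}. t i j)"
proof -
  have "(\<Prod>i\<in>{1..r}. \<Prod>j\<in>{i<..r}. t i j) = (\<Prod>(i, j)\<in>(SIGMA i:{1..r}. {i<..r}). t i j)"
    by (rule prod.Sigma) auto
  also have "(SIGMA i:{1..r}. {i<..r}) = {(i, j). i \<in> {1..r} \<and> j \<in> {1..r} \<and> i < j}"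
    by auto
  finally show ?thesis
    by (simp add: pair_prod_def)
qed

lemma sgn_cosh_node_diff:
  assumes "c > 0"
  shows "sgn (cosh_node c a - cosh_node c b) = sgn (\<bar>a\<bar> - \<bar>b\<bar>)"
proof -
  have "sgn (cosh_node c a - cosh_node c b) = sgn (a - b) * sgn (a + b)"
    by (simp only: cosh_node_diff sgn_mult sgn_snum[OF assms])
  also have "\<dots> = sgn (\<bar>a\<bar> - \<bar>b\<bar>)"
    by (simp add: sgn_if abs_if)
  finally show ?thesis .
qed

text \<open>
  The absolute values are \<open>sgn (\<bar>k i\<bar> - \<bar>k j\<bar>)\<close> times the differences of the nodes \<open>- cosh_node c k\<close>; with
  the nodes negated, \<open>p i\<close> below has the value \<open>\<Prod>a<i. cosh_node c (N / 2 - a) - cosh_node c k\<close>.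
\<close>

lemma sum_symmetric_form:
  assumes "c > 0" "2 * r \<le> N + 1"
  shows "(\<Sum>k\<in>{..<r} \<rightarrow>\<^sub>E unit_steps (real N / 2).
      pair_prod (\<lambda>i j. \<bar>snum c (k i - k j) * snum c (k i + k j)\<bar>) {..<r}
        * (\<Prod>i<r. \<bar>snum c (k i)\<bar> * weight c N 0 (k i)))
    = fact r * (\<Prod>j<r. 2 * tail c N j 0
        * (\<Prod>a<j. snum c (real (N - 2 * a)) * snum c (real (N - 2 * a - 1)))
        * (\<Prod>i<j. snum c (real j - real i) / snum c (real N - real i - real j)))"
proof -
  let ?U = "unit_steps (real N / 2)"
  let ?s = "\<lambda>a b. sgn (\<bar>a\<bar> - \<bar>b\<bar>) :: real" and ?y = "\<lambda>k. - cosh_node c k"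
  let ?w = "\<lambda>k. \<bar>snum c k\<bar> * weight c N 0 k"
  let ?Q = "\<lambda>i. \<Prod>a<i. snum c (real (N - 2 * a)) * snum c (real (N - 2 * a - 1))"
  define p where "p i = (\<Prod>a<i. [:cosh_node c (real N / 2 - real a), 1:])" for i
  have deg: "degree (p i) = i" for i
    unfolding p_def by (simp add: degree_prod_eq_sum_degree)
  have lead: "lead_coeff (p i) = 1" for i
    unfolding p_def lead_coeff_prod by simp
  have poly_p: "poly (p i) (?y k) = (\<Prod>a<i. cosh_node c (real N / 2 - real a) - cosh_node c k)" for i k
    by (simp add: p_def poly_prod)
  have kernel: "\<bar>snum c (a - b) * snum c (a + b)\<bar> = ?s a b * (?y b - ?y a)" for a b
    unfolding cosh_node_diff[symmetric] sgn_cosh_node_diff[OF assms(1), symmetric] by (simp add: abs_sgn mult.commute)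
  have antisym: "?s a b = - ?s b a" for a b
    by (simp add: sgn_if)
  have tie: "?s a b = 0" if "?y a = ?y b" for a b
    using that unfolding sgn_cosh_node_diff[OF assms(1), symmetric] by simp
  have "(\<Sum>k\<in>{..<r} \<rightarrow>\<^sub>E ?U. pair_prod (\<lambda>i j. \<bar>snum c (k i - k j) * snum c (k i + k j)\<bar>) {..<r}
        * (\<Prod>i<r. ?w (k i)))
      = (\<Sum>k\<in>{..<r} \<rightarrow>\<^sub>E ?U. pair_prod (\<lambda>i j. ?s (k i) (k j) * (?y (k j) - ?y (k i))) {..<r} * (\<Prod>i<r. ?w (k i)))"
    unfolding kernel ..
  also have "\<dots> = fact r * (\<Sum>k\<in>{..<r} \<rightarrow>\<^sub>E ?U. pair_prod (\<lambda>i j. ?s (k i) (k j)) {..<r}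
      * (\<Prod>i<r. poly (p i) (?y (k i)) * ?w (k i)))"
    by (rule sum_pair_prod_antisymmetrize[of ?s ?y p, OF antisym tie deg lead])
  also have "(\<Sum>k\<in>{..<r} \<rightarrow>\<^sub>E ?U. pair_prod (\<lambda>i j. ?s (k i) (k j)) {..<r}
      * (\<Prod>i<r. poly (p i) (?y (k i)) * ?w (k i)))
      = (\<Sum>k\<in>{..<r} \<rightarrow>\<^sub>E ?U. (\<Prod>i<r. ?Q i) * (pair_prod (\<lambda>i j. ?s (k i) (k j)) {..<r}
      * (\<Prod>i<r. \<bar>snum c (k i)\<bar> * weight c N i (k i))))"
  proof (rule sum.cong[OF refl])
    fix k assume k: "k \<in> {..<r} \<rightarrow>\<^sub>E ?U"
    have "(\<Prod>i<r. poly (p i) (?y (k i)) * ?w (k i)) = (\<Prod>i<r. ?Q i * (\<bar>snum c (k i)\<bar> * weight c N i (k i)))"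
    proof (rule prod.cong[OF refl])
      fix i assume i: "i \<in> {..<r}"
      then have w: "weight c N 0 (k i) * (\<Prod>a<i. cosh_node c (real N / 2 - real a) - cosh_node c (k i)) = ?Q i * weight c N i (k i)"
        using PiE_mem[OF k i] assms by (intro weight_zero_eq) auto
      have "poly (p i) (?y (k i)) * ?w (k i)
          = \<bar>snum c (k i)\<bar> * (weight c N 0 (k i) * (\<Prod>a<i. cosh_node c (real N / 2 - real a) - cosh_node c (k i)))"
        unfolding poly_p by (simp only: mult_ac)
      also have "\<dots> = ?Q i * (\<bar>snum c (k i)\<bar> * weight c N i (k i))"
        unfolding w by (simp only: mult_ac)
      finally show "poly (p i) (?y (k i)) * ?w (k i) = ?Q i * (\<bar>snum c (k i)\<bar> * weight c N i (k i))" .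
    qed
    then show "pair_prod (\<lambda>i j. ?s (k i) (k j)) {..<r} * (\<Prod>i<r. poly (p i) (?y (k i)) * ?w (k i))
        = (\<Prod>i<r. ?Q i) * (pair_prod (\<lambda>i j. ?s (k i) (k j)) {..<r} * (\<Prod>i<r. \<bar>snum c (k i)\<bar> * weight c N i (k i)))"
      unfolding prod.distrib by (simp only: mult_ac)
  qed
  also have "\<dots> = (\<Prod>i<r. ?Q i) * ((\<Prod>i<r. 2 * tail c N i 0)
      * pair_prod (\<lambda>i j. snum c (real j - real i) / snum c (real N - real i - real j)) {..<r})"
    unfolding sum_distrib_left[symmetric] sum_sgn_weights[OF assms] ..
  finally show ?thesis
    unfolding pair_prod_lessThan prod.distrib by (simp only: mult_ac)
qed

section \<open>Translation from q-shifted factorials and q-Gamma functions\<close>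

lemma
  assumes "0 < q" "q < 1" "a < 1"
  shows convergent_prod_qpoch_inf: "convergent_prod (\<lambda>k. 1 - a * q ^ k :: real)"
    and qpoch_inf_pos: "qpoch_inf a q > 0"
proof -
  have pos: "1 - a * q ^ k > 0" for k
  proof -
    have "q ^ k \<le> 1" "q ^ k > 0"
      using assms by (auto intro: power_le_one)
    then have "a * q ^ k < 1"
      using assms(3) by (cases "a \<le> 0") (auto intro: le_less_trans[OF mult_nonpos_nonneg] le_less_trans[OF mult_left_le])
    then show ?thesis
      by simp
  qed
  have "summable (\<lambda>k. norm (- a * q ^ k))"
    using assms by (simp add: abs_mult power_abs summable_mult summable_geometric)
  then have "abs_convergent_prod (\<lambda>k. 1 + (- a * q ^ k))"
    by (intro summable_imp_abs_convergent_prod) simp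
  then show conv: "convergent_prod (\<lambda>k. 1 - a * q ^ k)"
    by (intro abs_convergent_prod_imp_convergent_prod) simp
  show "qpoch_inf a q > 0"
    unfolding qpoch_inf_def by (rule less_0_prodinf[OF conv pos])
qed

lemma qpoch_inf_split:
  assumes "0 < q" "q < 1" "a < 1"
  shows "qpoch_inf a q = (1 - a) * qpoch_inf (a * q) q"
proof -
  have "1 - a * q ^ 0 \<noteq> 0"
    using assms by simp
  with prodinf_split_head[OF convergent_prod_qpoch_inf[OF assms]]
  show ?thesis
    using assms by (simp add: qpoch_inf_def mult_ac)
qed

lemma qpoch_0: "0 < q \<Longrightarrow> q < 1 \<Longrightarrow> a < 1 \<Longrightarrow> qpoch a q 0 = 1"
  using qpoch_inf_pos[of q a] by (simp add: qpoch_def)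

lemma qpoch_step:
  assumes "0 < q" "q < 1" "a < 1" "a * q powi k < 1"
  shows "qpoch a q (k + 1) = qpoch a q k * (1 - a * q powi k)"
proof -
  have "q powi (k + 1) = q powi k * q"
    using assms by (simp add: power_int_add)
  then have "qpoch_inf (a * q powi k) q = (1 - a * q powi k) * qpoch_inf (a * q powi (k + 1)) q"
    using qpoch_inf_split[OF assms(1,2,4)] by (simp add: mult.assoc)
  moreover have "1 - a * q powi k \<noteq> 0"
    using assms by simp
  ultimately show ?thesis
    unfolding qpoch_def by simp
qed

lemma qGamma_1: "0 < q \<Longrightarrow> q < 1 \<Longrightarrow> qGamma q 1 = 1"
  using qpoch_inf_pos[of q q] by (simp add: qGamma_def)

lemma powr_less_1:
  fixes q x :: real
  assumes "0 < q" "q < 1" "x > 0"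
  shows "q powr x < 1"
  using powr_less_mono2[of x q 1] assms by simp

lemma qGamma_pos:
  assumes "0 < q" "q < 1" "x > 0"
  shows "qGamma q x > 0"
proof -
  have "q powr x < 1"
    using assms by (rule powr_less_1)
  then show ?thesis
    using assms qpoch_inf_pos[of q q] qpoch_inf_pos[of q "q powr x"] by (simp add: qGamma_def)
qed

lemma qGamma_plus1:
  assumes "0 < q" "q < 1" "x > 0"
  shows "qGamma q (x + 1) = qbracket q x * qGamma q x"
proof -
  have less: "q powr x < 1"
    using assms by (rule powr_less_1)
  have "q powr (x + 1) = q powr x * q"
    using assms by (simp add: powr_add)
  then have inf: "qpoch_inf (q powr x) q = (1 - q powr x) * qpoch_inf (q powr (x + 1)) q"
    using qpoch_inf_split[OF assms(1,2) less] by simp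
  have pow: "(1 - q) powr (1 - x) = (1 - q) * (1 - q) powr (1 - (x + 1))"
    using assms by (simp add: powr_diff powr_minus field_simps)
  show ?thesis
    unfolding qGamma_def qbracket_def inf pow using less assms(2) by simp
qed

lemma qbracket_eq_snum:
  assumes "0 < q" "q < 1"
  defines "c \<equiv> - ln q / 2"
  shows "qbracket q x = q powr ((x - 1) / 2) * snum c x"
proof -
  have q: "q powr y = exp (- (2 * c * y))" for y
    using assms(1) by (simp add: powr_def c_def)
  have q1: "q = exp (- (2 * c))"
    using q[of 1] assms(1) by simp
  have "sinh (c * x) = exp (c * x) * (1 - exp (- (2 * c * x))) / 2" for x
    by (simp add: sinh_def algebra_simps flip: exp_add)
  note sinh_c = this
  have "sinh c = exp c * (1 - q) / 2"
    using sinh_c[of 1] by (subst q1) simp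
  then have s: "snum c x = exp (c * x) * (1 - q powr x) / (exp c * (1 - q))"
    unfolding snum_def q[of x] sinh_c[of x] by simp
  have "q powr ((x - 1) / 2) * exp (c * x) = exp c"
    unfolding q exp_add[symmetric] by (simp add: field_simps)
  then have "q powr ((x - 1) / 2) * snum c x = exp c * (1 - q powr x) / (exp c * (1 - q))"
    unfolding s by (metis mult.assoc times_divide_eq_right)
  then show ?thesis
    by (simp add: qbracket_def)
qed

lemma qpoch_self:
  assumes "0 < q" "q < 1"
  defines "c \<equiv> - ln q / 2"
  shows "qpoch q q (int L) = (1 - q) ^ L * q powr (real L * (real L - 1) / 4) * sfact c L"
proof (induction L)
  case 0
  show ?case
    using assms by (simp add: qpoch_0 sfact_def)
next
  case (Suc L)
  have power: "q * q powi int L = q powr real (Suc L)"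
    using powr_realpow[OF assms(1), of "Suc L"] by simp
  have "q powr real (Suc L) < 1"
    by (rule powr_less_1) (use assms in simp_all)
  then have "qpoch q q (int L + 1) = qpoch q q (int L) * (1 - q powr real (Suc L))"
    using qpoch_step[of q q "int L"] assms(1,2) unfolding power by simp
  also have "1 - q powr real (Suc L) = (1 - q) * qbracket q (real (Suc L))"
    using assms by (simp add: qbracket_def)
  also have "\<dots> = (1 - q) * (q powr (real L / 2) * snum c (real (Suc L)))"
    unfolding qbracket_eq_snum[OF assms(1,2)] c_def by simp
  finally have "qpoch q q (int (Suc L)) = (1 - q) ^ Suc L
      * (q powr (real L * (real L - 1) / 4) * q powr (real L / 2)) * sfact c (Suc L)"
    unfolding Suc.IH sfact_Suc by (simp add: add.commute mult_ac)
  also have "q powr (real L * (real L - 1) / 4) * q powr (real L / 2)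
      = q powr (real (Suc L) * (real (Suc L) - 1) / 4)"
    unfolding powr_add[symmetric] by (simp add: field_simps)
  finally show ?case .
qed

lemma qbinomial_eq_sbinom:
  assumes "0 < q" "q < 1" "j \<le> N"
  defines "c \<equiv> - ln q / 2"
  shows "qbinomial q (int N) (int j) = q powr (real j * (real N - real j) / 2) * sbinom c N (int j)"
proof -
  have c: "c > 0"
    using assms by (simp add: c_def)
  have sub: "int N - int j = int (N - j)"
    using assms(3) by simp
  have pw: "(1 - q) ^ N = (1 - q) ^ j * (1 - q) ^ (N - j)"
    using assms(3) by (simp flip: power_add)
  let ?e = "\<lambda>L. q powr (real L * (real L - 1) / 4)"
  have e: "?e N = ?e j * ?e (N - j) * q powr (real j * (real N - real j) / 2)"
  proof -
    have "real N * (real N - 1) / 4 = real j * (real j - 1) / 4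
        + real (N - j) * (real (N - j) - 1) / 4 + real j * (real N - real j) / 2"
      using assms(3) by (simp add: of_nat_diff field_simps)
    then show ?thesis
      by (simp only: powr_add)
  qed
  have "sfact c j > 0" "sfact c (N - j) > 0" "?e j > 0" "?e (N - j) > 0" "(1 - q) ^ j > 0" "(1 - q) ^ (N - j) > 0"
    using c assms by (simp_all add: sfact_pos)
  moreover have "sbinom c N (int j) = sfact c N / (sfact c j * sfact c (N - j))"
  proof -
    have "nat (int N - int j) = N - j"
      using assms(3) by simp
    then show ?thesis
      using assms(3) by (simp only: sbinom_def nat_int) simp
  qed
  ultimately show ?thesis
    unfolding qbinomial_def sub qpoch_self[OF assms(1,2)] c_def[symmetric] pw e
    using assms(1,2) by (simp add: field_simps)
qed

lemma sqrt_powi: "0 < q \<Longrightarrow> sqrt q powi k = q powr (real_of_int k / 2)"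
  using powr_real_of_int'[of "sqrt q" k] by (simp add: powr_powr flip: powr_half_sqrt)

lemma qGamma_Suc:
  assumes "0 < q" "q < 1"
  defines "c \<equiv> - ln q / 2"
  shows "qGamma q (real j + 1) = q powr (real j * (real j - 1) / 4) * sfact c j"
proof (induction j)
  case 0
  show ?case
    using assms by (simp add: qGamma_1 sfact_def)
next
  case (Suc j)
  have "qGamma q (real (Suc j) + 1) = qbracket q (real (Suc j)) * qGamma q (real j + 1)"
    using qGamma_plus1[OF assms(1,2), of "real (Suc j)"] by (simp add: add.commute)
  also have "\<dots> = (q powr ((real (Suc j) - 1) / 2) * q powr (real j * (real j - 1) / 4)) * sfact c (Suc j)"
    unfolding Suc.IH qbracket_eq_snum[OF assms(1,2)] c_def[symmetric] sfact_Suc by (simp only: mult_ac)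
  also have "q powr ((real (Suc j) - 1) / 2) * q powr (real j * (real j - 1) / 4)
      = q powr (real (Suc j) * (real (Suc j) - 1) / 4)"
  proof -
    have "(real (Suc j) - 1) / 2 + real j * (real j - 1) / 4 = real (Suc j) * (real (Suc j) - 1) / 4"
      by (simp add: field_simps)
    then show ?thesis
      by (simp only: powr_add[symmetric])
  qed
  finally show ?case .
qed

lemma sfact_falling: "j \<le> M \<Longrightarrow> sfact c M = (\<Prod>i<j. snum c (real M - real i)) * sfact c (M - j)"
proof (induction j)
  case (Suc j)
  then have "M - j = Suc (M - Suc j)"
    by simp
  then have "sfact c (M - j) = snum c (real M - real j) * sfact c (M - Suc j)"
    using Suc.prems by (simp add: sfact_Suc of_nat_diff)
  then show ?case
    using Suc by simp
qed simp

lemma one_plus_powr_eq_bracket: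
  assumes "0 < q" "q < 1" "x > 0"
  shows "1 + q powr x = qbracket q (2 * x) / qbracket q x"
proof -
  have "q powr (2 * x) = q powr x * q powr x"
    by (simp flip: powr_add)
  then have "1 - q powr (2 * x) = (1 - q powr x) * (1 + q powr x)"
    by (simp add: algebra_simps)
  moreover have "q powr x < 1"
    using assms by (rule powr_less_1)
  ultimately show ?thesis
    using assms unfolding qbracket_def by simp
qed

text \<open>
  The two arguments on the left are those on the right, in this order for even \<open>L\<close> and in the
  opposite order for odd \<open>L\<close>.
\<close>

lemma snum_half_shift:
  "snum c (real L / 2 + 1) * snum c ((real L + 1) / 2)
    = snum c (real (L div 2) + 1) * snum c (real (Suc L div 2) + 1 / 2)"
proof (cases "even L")
  case True
  then obtain f where "L = 2 * f"
    by (rule evenE)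
  then show ?thesis
    by (simp add: add_divide_distrib)
next
  case False
  then obtain f where "L = 2 * f + 1"
    by (rule oddE)
  then show ?thesis
    by (simp add: add_divide_distrib add.commute)
qed

text \<open>
  The value of \<open>(\<lceil>n\<rceil> - n) gchoose 2\<close> for \<open>n = L / 2\<close>.
\<close>

definition parity_shift :: "nat \<Rightarrow> real" where
  "parity_shift L = (if odd L then - 1 / 8 else 0)"

text \<open>
  In view of \<open>sum_weight_single\<close>, this is the case \<open>r = 1\<close> of the theorem. Passing from \<open>L\<close> to \<open>L + 2\<close> multiplies the left-hand
  side by \<open>(1 + q^(L/2)) (1 + q^((L+1)/2))\<close> from the shifted factorial and by one quotient of q-numbers
  from the Gamma functions. Writing \<open>1 + q^x\<close> as the quotient of the q-numbers of \<open>2 x\<close> and \<open>x\<close> makes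
  this the recurrence of the binomial coefficient.
\<close>

lemma qGamma_quotient_eq_tail:
  fixes L :: nat
  assumes "0 < q" "q < 1" "L > 0"
  defines "c \<equiv> - ln q / 2"
  shows "qpoch (- q) (sqrt q) (int L - 2)
      * (qGamma q (real (Suc L div 2) + 1 / 2) / (qGamma q (3 / 2) * qGamma q (real (Suc L div 2))))
    = q powr (real L ^ 2 / 8 - 1 / 2 - parity_shift L) * (snum c (real L / 2) * sbinom c (L - 1) (int (L div 2)))"
  using assms(3)
proof (induction L rule: induct_nat_012)
  case 1
  have c: "c > 0"
    using assms by (simp add: c_def)
  have minus_sqrt: "(- q) * sqrt q powi (- 1) = - sqrt q"
    using assms(1) by (simp add: power_int_minus field_simps)
  have "(- q) * sqrt q powi (- 1) < 1"
    unfolding minus_sqrt using assms(1) by (smt (verit) real_sqrt_gt_0_iff)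
  \<comment> \<open>The shifted factorial of index \<open>- 1\<close> is \<open>1 / (1 + sqrt q)\<close>.\<close>
  then have "qpoch (- q) (sqrt q) (- 1 + 1) = qpoch (- q) (sqrt q) (- 1) * (1 - (- q) * sqrt q powi (- 1))"
    by (intro qpoch_step) (use assms in auto)
  moreover have "qpoch (- q) (sqrt q) 0 = 1"
    by (rule qpoch_0) (use assms in auto)
  ultimately have "qpoch (- q) (sqrt q) (- 1) * (1 + sqrt q) = 1"
    unfolding minus_sqrt by simp
  moreover have "1 + sqrt q \<noteq> 0"
    using assms(1) by (smt (verit) real_sqrt_gt_0_iff)
  ultimately have "qpoch (- q) (sqrt q) (- 1) = 1 / (1 + sqrt q)"
    by (simp add: eq_divide_eq)
  also have "\<dots> = qbracket q (1 / 2)"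
  proof -
    have "1 - q = (1 - sqrt q) * (1 + sqrt q)"
      using assms(1) by (simp add: field_simps)
    moreover have "1 - sqrt q \<noteq> 0" "1 + sqrt q \<noteq> 0"
      using assms(1,2) by (auto simp: add_nonneg_eq_0_iff)
    ultimately show ?thesis
      unfolding qbracket_def powr_half_sqrt[OF less_imp_le[OF assms(1)]] by simp
  qed
  also have "\<dots> = q powr (- 1 / 4) * snum c (1 / 2)"
    unfolding qbracket_eq_snum[OF assms(1,2)] c_def by simp
  finally have "qpoch (- q) (sqrt q) (- 1) = q powr (- 1 / 4) * snum c (1 / 2)" .
  moreover have "sbinom c 0 0 = 1"
    by (simp add: sbinom_def sfact_def)
  ultimately show ?case
    using qGamma_pos[OF assms(1,2), of "3 / 2"] qGamma_1[OF assms(1,2)] by (simp add: parity_shift_def)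
next
  case (ge2 L)
  have c: "c > 0"
    using assms by (simp add: c_def)
  show ?case
  proof (cases "L = 0")
    case True
    have "snum c 1 = 1" "sbinom c 1 1 = 1"
      using c by (simp_all add: snum_def sbinom_def sfact_def)
    moreover have "qpoch (- q) (sqrt q) 0 = 1"
      by (rule qpoch_0) (use assms in auto)
    ultimately show ?thesis
      using qGamma_pos[OF assms(1,2), of "3 / 2"] qGamma_1[OF assms(1,2)] True assms(1)
      by (simp add: parity_shift_def)
  next
    case False
    then obtain M where L: "L = Suc M"
      by (metis not0_implies_Suc)
    define C where "C = Suc L div 2"
    define f where "f = L div 2"
    have C: "C > 0" "real (Suc (Suc (Suc L)) div 2) = real C + 1" and f: "Suc (Suc L) div 2 = Suc f"
      using L by (simp_all add: C_def f_def)
    have L_eq: "L = f + C"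
      unfolding C_def f_def by presburger
    have IH: "qpoch (- q) (sqrt q) (int L - 2) * (qGamma q (real C + 1 / 2) / (qGamma q (3 / 2) * qGamma q (real C)))
      = q powr (real L ^ 2 / 8 - 1 / 2 - parity_shift L) * (snum c (real L / 2) * sbinom c M (int f))"
      using ge2.IH(1) False by (simp add: C_def f_def L)
    have neg: "- q * sqrt q powi k = - (q powr (1 + real_of_int k / 2))" for k
      using assms(1) by (simp add: sqrt_powi powr_add)
    have neg_less: "- q * sqrt q powi k < 1" for k
    proof -
      have "q powr (1 + real_of_int k / 2) \<ge> 0"
        by simp
      then show ?thesis
        unfolding neg by linarith
    qed
    have step: "qpoch (- q) (sqrt q) (k + 1) = qpoch (- q) (sqrt q) k * (1 + q powr (1 + real_of_int k / 2))" for k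
      using qpoch_step[of "sqrt q" "- q" k] assms(1,2) neg_less[of k] unfolding neg by simp
    have bracket: "1 + q powr x = q powr (x / 2) * (snum c (2 * x) / snum c x)" if "x > 0" for x
    proof -
      have "q powr ((2 * x - 1) / 2) = q powr (x / 2) * q powr ((x - 1) / 2)"
        unfolding powr_add[symmetric] by (simp add: field_simps)
      then show ?thesis
        unfolding one_plus_powr_eq_bracket[OF assms(1,2) that] qbracket_eq_snum[OF assms(1,2)] c_def[symmetric]
        using assms(1) by simp
    qed
    have poch: "qpoch (- q) (sqrt q) (int (Suc (Suc L)) - 2)
        = qpoch (- q) (sqrt q) (int L - 2) * (q powr (real L / 4) * (snum c (real L) / snum c (real L / 2)))
          * (q powr ((real L + 1) / 4) * (snum c (real L + 1) / snum c ((real L + 1) / 2)))"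
    proof -
      have e: "int L - 2 + 1 = int L - 1" "int L - 1 + 1 = int (Suc (Suc L)) - 2"
        "1 + real_of_int (int L - 2) / 2 = real L / 2" "1 + real_of_int (int L - 1) / 2 = (real L + 1) / 2"
        "2 * (real L / 2) = real L" "2 * ((real L + 1) / 2) = real L + 1"
        "real L / 2 / 2 = real L / 4" "(real L + 1) / 2 / 2 = (real L + 1) / 4"
        by (simp_all add: field_simps)
      have pos: "real L / 2 > 0" "(real L + 1) / 2 > 0"
        using False by simp_all
      show ?thesis
        using step[of "int L - 2"] step[of "int L - 1"] bracket[OF pos(1)] bracket[OF pos(2)]
        unfolding e by (simp only:)
    qed
    have gamma: "qGamma q (real C + 1 + 1 / 2) / (qGamma q (3 / 2) * qGamma q (real C + 1))
        = q powr (1 / 4) * (snum c (real C + 1 / 2) / snum c (real C))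
          * (qGamma q (real C + 1 / 2) / (qGamma q (3 / 2) * qGamma q (real C)))"
    proof -
      have "q powr ((real C + 1 / 2 - 1) / 2) = q powr (1 / 4) * q powr ((real C - 1) / 2)"
        unfolding powr_add[symmetric] by (simp add: field_simps)
      moreover have "real C + 1 + 1 / 2 = (real C + 1 / 2) + 1"
        by simp
      ultimately show ?thesis
        using qGamma_plus1[OF assms(1,2), of "real C"] qGamma_plus1[OF assms(1,2), of "real C + 1 / 2"] C(1) assms(1)
        unfolding qbracket_eq_snum[OF assms(1,2)] c_def[symmetric] by (simp add: mult_ac)
    qed
    have nz: "snum c (real L / 2) \<noteq> 0" "snum c ((real L + 1) / 2) \<noteq> 0" "snum c (real C) \<noteq> 0" "snum c (real f + 1) \<noteq> 0"
      using False C(1) by (simp_all add: snum_nonzero[OF c])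
    have binom: "sbinom c (Suc L) (int (Suc f)) * (snum c (real f + 1) * snum c (real C))
        = snum c (real L + 1) * snum c (real L) * sbinom c M (int f)"
    proof -
      have "real (Suc (Suc M)) - real_of_int (int (Suc f)) = real C" "int (Suc f) - 1 = int f"
        "real (Suc (Suc M)) = real L + 1" "real (Suc M) = real L"
        using L_eq L by simp_all
      then show ?thesis
        using sbinom_lower_upper[OF c, of M "int (Suc f)"] L by (simp add: add.commute)
    qed
    have expo: "real (Suc (Suc L)) ^ 2 / 8 - 1 / 2 - parity_shift (Suc (Suc L))
        = real L / 4 + (real L + 1) / 4 + 1 / 4 + (real L ^ 2 / 8 - 1 / 2 - parity_shift L)"
      by (simp add: parity_shift_def power2_eq_square field_simps)
    have half: "real (Suc (Suc L)) / 2 = real L / 2 + 1"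
      by (simp add: field_simps)
    have amplitude: "snum c (real L / 2 + 1) * sbinom c (Suc L) (int (Suc f))
        = snum c (real L) / snum c (real L / 2) * (snum c (real L + 1) / snum c ((real L + 1) / 2))
          * (snum c (real C + 1 / 2) / snum c (real C)) * (snum c (real L / 2) * sbinom c M (int f))"
    proof -
      have "sbinom c (Suc L) (int (Suc f)) = snum c (real L + 1) * snum c (real L) * sbinom c M (int f)
          / (snum c (real f + 1) * snum c (real C))"
        using binom nz by (simp add: field_simps)
      moreover have "snum c (real L / 2 + 1) = snum c (real f + 1) * snum c (real C + 1 / 2) / snum c ((real L + 1) / 2)"
        using snum_half_shift[of c L] nz unfolding f_def[symmetric] C_def[symmetric] by (simp add: field_simps)
      ultimately show ?thesis
        using nz by (simp add: field_simps)
    qed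
    have "qpoch (- q) (sqrt q) (int (Suc (Suc L)) - 2)
        * (qGamma q (real C + 1 + 1 / 2) / (qGamma q (3 / 2) * qGamma q (real C + 1)))
      = q powr (real L / 4) * q powr ((real L + 1) / 4) * q powr (1 / 4)
        * (snum c (real L) / snum c (real L / 2) * (snum c (real L + 1) / snum c ((real L + 1) / 2))
          * (snum c (real C + 1 / 2) / snum c (real C)))
        * (qpoch (- q) (sqrt q) (int L - 2) * (qGamma q (real C + 1 / 2) / (qGamma q (3 / 2) * qGamma q (real C))))"
      unfolding poch gamma by (simp only: mult_ac)
    also have "\<dots> = q powr (real (Suc (Suc L)) ^ 2 / 8 - 1 / 2 - parity_shift (Suc (Suc L)))
        * (snum c (real L / 2 + 1) * sbinom c (Suc L) (int (Suc f)))"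
      unfolding IH amplitude expo powr_add by (simp only: mult_ac)
    finally show ?thesis
      unfolding C(2) f half by simp
  qed
qed simp

text \<open>
  All finite products are quotients of q-factorials; on both sides they combine to
  \<open>j! N! / (N - j)!\<close>, and the case \<open>r = 1\<close> for \<open>N - 2 j\<close> remains.
\<close>

lemma qGamma_factor_eq:
  assumes "0 < q" "q < 1" "2 * j < N"
  defines "c \<equiv> - ln q / 2"
  shows "qpoch (- q) (sqrt q) (int N - 2 * int (Suc j)) * (qGamma q (real (Suc j)) / qGamma q (3 / 2))
      * (qGamma q (real N + 1) * qGamma q (real (Suc N div 2) - real (Suc j) + 3 / 2)
        / (qGamma q (real N - real (Suc j) + 2) * qGamma q (real (Suc N div 2) - real (Suc j) + 1)))
    = q powr (real N ^ 2 / 8 + (real j ^ 2 - real j - 1) / 2 - parity_shift N)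
      * (tail c N j 0 * (\<Prod>a<j. snum c (real (N - 2 * a)) * snum c (real (N - 2 * a - 1)))
        * (\<Prod>i<j. snum c (real j - real i) / snum c (real N - real i - real j)))"
proof -
  have c: "c > 0"
    using assms by (simp add: c_def)
  define L where "L = N - 2 * j"
  have N: "N = L + 2 * j" and "L > 0"
    using assms(3) by (simp_all add: L_def)
  have "Suc N div 2 = Suc L div 2 + j"
    using N by simp
  then have ceil: "real (Suc N div 2) - real (Suc j) + 3 / 2 = real (Suc L div 2) + 1 / 2"
    "real (Suc N div 2) - real (Suc j) + 1 = real (Suc L div 2)"
    by simp_all
  have args: "real N - real (Suc j) + 2 = real (N - j) + 1" "real (Suc j) = real j + 1"
    "int N - 2 * int (Suc j) = int L - 2"
    using N by simp_all
  have pos: "sfact c i > 0" for i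
    using c by (rule sfact_pos)
  have double: "(\<Prod>a<j. snum c (real (N - 2 * a)) * snum c (real (N - 2 * a - 1))) = sfact c N / sfact c L"
  proof -
    have "sfact c N = (\<Prod>a<j'. snum c (real (N - 2 * a)) * snum c (real (N - 2 * a - 1))) * sfact c (N - 2 * j')"
      if "2 * j' \<le> N" for j'
      using that
    proof (induction j')
      case (Suc j')
      then have "N - 2 * j' = Suc (Suc (N - 2 * Suc j'))" "N - 2 * j' - 1 = Suc (N - 2 * Suc j')"
        by simp_all
      then have "sfact c (N - 2 * j') = snum c (real (N - 2 * j')) * snum c (real (N - 2 * j' - 1)) * sfact c (N - 2 * Suc j')"
        by (simp only: sfact_Suc mult.assoc)
      then show ?case
        using Suc by simp
    qed simp
    from this[of j] show ?thesis
      using assms(3) pos[of L] by (simp add: L_def)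
  qed
  have numer: "(\<Prod>i<j. snum c (real j - real i)) = sfact c j"
    using sfact_falling[of j j c] by (simp add: sfact_def)
  have denom: "(\<Prod>i<j. snum c (real N - real i - real j)) = sfact c (N - j) / sfact c L"
  proof -
    have "(\<Prod>i<j. snum c (real N - real i - real j)) = (\<Prod>i<j. snum c (real (N - j) - real i))"
      by (rule prod.cong) (use N in \<open>simp_all add: algebra_simps\<close>)
    moreover have "N - j - j = L" "j \<le> N - j"
      using N by simp_all
    ultimately show ?thesis
      using sfact_falling[of j "N - j" c] pos[of L] by simp
  qed
  have tail: "tail c N j 0 = snum c (real L / 2) * sbinom c (L - 1) (int (L div 2))"
  proof -
    have "real N / 2 - real j = real L / 2"
      by (simp add: N field_simps)
    moreover have "int (N div 2 + 0) - int j = int (L div 2)"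
      using N by simp
    ultimately have "tail c N j 0 = snum c (real L / 2) * sbinom c (L - 1) (int (L div 2))"
      by (simp only: tail_def L_def)
    then show ?thesis .
  qed
  have par: "parity_shift N = parity_shift L"
    by (simp add: parity_shift_def N)
  have gamma: "qGamma q (real j + 1) * (qGamma q (real N + 1) / qGamma q (real (N - j) + 1))
      = q powr (real j * (real N - 1) / 2) * (sfact c j * sfact c N / sfact c (N - j))"
  proof -
    have "real j * (real j - 1) / 4 + real N * (real N - 1) / 4
        = real j * (real N - 1) / 2 + real (N - j) * (real (N - j) - 1) / 4"
      using N by (simp add: field_simps)
    then have "q powr (real j * (real j - 1) / 4) * q powr (real N * (real N - 1) / 4)
        = q powr (real j * (real N - 1) / 2) * q powr (real (N - j) * (real (N - j) - 1) / 4)"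
      by (simp only: powr_add[symmetric])
    then show ?thesis
      unfolding qGamma_Suc[OF assms(1,2)] c_def[symmetric] using assms(1) pos[of "N - j"]
      by (simp add: field_simps)
  qed
  have expo: "real N ^ 2 / 8 + (real j ^ 2 - real j - 1) / 2 - parity_shift N
      = real j * (real N - 1) / 2 + (real L ^ 2 / 8 - 1 / 2 - parity_shift L)"
    unfolding par by (simp add: N power2_eq_square field_simps)
  have "qpoch (- q) (sqrt q) (int L - 2) * (qGamma q (real j + 1) / qGamma q (3 / 2))
      * (qGamma q (real N + 1) * qGamma q (real (Suc L div 2) + 1 / 2)
        / (qGamma q (real (N - j) + 1) * qGamma q (real (Suc L div 2))))
    = qGamma q (real j + 1) * (qGamma q (real N + 1) / qGamma q (real (N - j) + 1))
      * (qpoch (- q) (sqrt q) (int L - 2)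
        * (qGamma q (real (Suc L div 2) + 1 / 2) / (qGamma q (3 / 2) * qGamma q (real (Suc L div 2)))))"
    by (simp add: mult_ac)
  also have "\<dots> = q powr (real N ^ 2 / 8 + (real j ^ 2 - real j - 1) / 2 - parity_shift N)
      * (tail c N j 0 * (sfact c j * sfact c N / sfact c (N - j)))"
    unfolding gamma qGamma_quotient_eq_tail[OF assms(1,2) \<open>L > 0\<close>] c_def[symmetric] tail expo powr_add
    by (simp only: mult_ac)
  also have "tail c N j 0 * (sfact c j * sfact c N / sfact c (N - j))
      = tail c N j 0 * (sfact c N / sfact c L) * (sfact c j / (sfact c (N - j) / sfact c L))"
    using pos[of L] by simp
  finally show ?thesis
    unfolding ceil args(1,3) prod_dividef double numer denom by (simp only: args(2))
qed

lemma ceiling_half: "\<lceil>real N / 2\<rceil> = int (Suc N div 2)"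
proof (rule ceiling_unique)
  have "2 * int (Suc N div 2) < int N + 2" "int N \<le> 2 * int (Suc N div 2)"
    by presburger+
  then have "2 * real_of_int (int (Suc N div 2)) < real N + 2" "real N \<le> 2 * real_of_int (int (Suc N div 2))"
    by linarith+
  then show "real_of_int (int (Suc N div 2)) - 1 < real N / 2" "real N / 2 \<le> real_of_int (int (Suc N div 2))"
    by linarith+
qed

lemma parity_shift_eq: "(real_of_int \<lceil>real N / 2\<rceil> - real N / 2) gchoose 2 = parity_shift N"
proof (cases "even N")
  case True
  then obtain f where "N = 2 * f"
    by (rule evenE)
  then show ?thesis
    by (simp add: ceiling_half gchoose_2_real parity_shift_def)
next
  case False
  then obtain f where "N = 2 * f + 1"
    by (rule oddE)
  then have "real_of_int (int (Suc N div 2)) - real N / 2 = 1 / 2"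
    by (simp add: field_simps)
  then show ?thesis
    using False by (simp only: ceiling_half gchoose_2_real parity_shift_def) simp
qed

lemma abs_qbracket_pair:
  assumes "0 < q" "q < 1"
  defines "c \<equiv> - ln q / 2"
  shows "\<bar>qbracket q (a - b) * qbracket q (a + b)\<bar> = q powr (a - 1) * \<bar>snum c (a - b) * snum c (a + b)\<bar>"
proof -
  have "(a - b - 1) / 2 + (a + b - 1) / 2 = a - 1"
    by (simp add: field_simps)
  then have "q powr (a - 1) = q powr ((a - b - 1) / 2) * q powr ((a + b - 1) / 2)"
    by (simp only: powr_add[symmetric])
  then show ?thesis
    unfolding qbracket_eq_snum[OF assms(1,2)] c_def[symmetric] by (simp add: abs_mult)
qed

text \<open>
  With \<open>s = r - i\<close>, the first power of \<open>q\<close> is what the brackets of the pairs \<open>(i, j)\<close>, \<open>j > i\<close>, leave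
  over when they are made symmetric. It cancels the linear term in \<open>a\<close> that \<open>s\<close> brings into the
  exponent \<open>(a - s) gchoose 2\<close>; the bracket of \<open>a\<close> cancels the rest of the linear term, and the
  binomial coefficient the quadratic one.
\<close>

lemma summand_factor_eq:
  assumes "0 < q" "q < 1" and a: "a \<in> unit_steps (real N / 2)"
  defines "c \<equiv> - ln q / 2"
  shows "q powr (s * (a - 1)) * (\<bar>qbracket q a\<bar> * q powr (((a - s) gchoose 2) - P) * qbinomial q (int N) \<lfloor>real N / 2 + a\<rfloor>)
    = q powr (real N ^ 2 / 8 + (s ^ 2 - s - 1) / 2 - P) * (\<bar>snum c a\<bar> * weight c N 0 a)"
proof -
  obtain p where p: "a = real p - real N / 2" "p \<le> N"
    using a unfolding unit_steps_half by auto
  have "real N / 2 + a = real_of_int (int p)" "a + real N / 2 = real_of_int (int p)"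
    using p by simp_all
  then have fl: "\<lfloor>real N / 2 + a\<rfloor> = int p" "\<lfloor>a + real N / 2\<rfloor> = int p"
    by (simp_all only: floor_of_int)
  have "s * (a - 1) + (a - 1) / 2 + ((a - s) * (a - s - 1) / 2 - P) + real p * (real N - real p) / 2
      = real N ^ 2 / 8 + (s ^ 2 - s - 1) / 2 - P"
    unfolding p(1) by (simp add: power2_eq_square field_simps)
  then have "q powr (real N ^ 2 / 8 + (s ^ 2 - s - 1) / 2 - P)
      = q powr (s * (a - 1)) * q powr ((a - 1) / 2) * q powr ((a - s) * (a - s - 1) / 2 - P)
        * q powr (real p * (real N - real p) / 2)"
    by (simp only: powr_add[symmetric])
  then show ?thesis
    unfolding weight_def fl qbinomial_eq_sbinom[OF assms(1,2) p(2)] qbracket_eq_snum[OF assms(1,2)]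
      gchoose_2_real c_def[symmetric]
    by (simp add: abs_mult)
qed

lemma abs_snum_pair_commute:
  "\<bar>snum c (a - b) * snum c (a + b)\<bar> = \<bar>snum c (b - a) * snum c (b + a)\<bar>"
  using snum_minus[of c "b - a"] by (simp add: abs_mult add.commute)

lemma bij_betw_Suc_lessThan: "bij_betw Suc {..<r} {1..r}"
  by (simp add: bij_betw_def lessThan_atLeast0 image_Suc_atLeastLessThan atLeastLessThanSuc_atLeastAtMost)

theorem proposition5p2:
  fixes q n :: real and r :: nat
  assumes "0 < q" and "q < 1"
    and "r \<ge> 1"
    and "n \<in> \<int> \<or> n - 1 / 2 \<in> \<int>"
    and "n \<ge> real r - 1 / 2"
  shows "(\<Sum>k\<in>{1..r} \<rightarrow>\<^sub>E unit_steps n.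
            (\<Prod>i\<in>{1..r}. \<Prod>j\<in>{i<..r}. \<bar>qbracket q (k i - k j) * qbracket q (k i + k j)\<bar>) *
            (\<Prod>i\<in>{1..r}. \<bar>qbracket q (k i)\<bar> *
               q powr (((k i - real r + real i) gchoose 2) - ((real_of_int \<lceil>n\<rceil> - n) gchoose 2)) *
               qbinomial q \<lfloor>2 * n\<rfloor> \<lfloor>n + k i\<rfloor>))
       = 2 ^ r * fact r *
         (\<Prod>i\<in>{1..r}. qpoch (- q) (sqrt q) (\<lfloor>2 * n\<rfloor> - 2 * int i) *
            (qGamma q (real i) / qGamma q (3 / 2)) *
            ((qGamma q (2 * n + 1) * qGamma q (real_of_int \<lceil>n\<rceil> - real i + 3 / 2)) /
             (qGamma q (2 * n - real i + 2) * qGamma q (real_of_int \<lceil>n\<rceil> - real i + 1))))"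
proof -
  define c where "c = - ln q / 2"
  have c: "c > 0"
    using assms by (simp add: c_def)
  define N where "N = nat \<lfloor>2 * n\<rfloor>"
  have "2 * n \<ge> 1"
    using assms(3,5) by linarith
  then have N: "real N = 2 * n"
    using floor_double_exact[OF assms(4)] by (simp add: N_def)
  then have n: "n = real N / 2"
    by simp
  have bound: "2 * r \<le> N + 1"
    using assms(5) unfolding n by linarith
  have floor: "\<lfloor>2 * (real N / 2)\<rfloor> = int N"
    by simp
  let ?U = "unit_steps (real N / 2)"
  let ?B = "\<lambda>a b. \<bar>snum c (a - b) * snum c (a + b)\<bar>" and ?w = "\<lambda>a. \<bar>snum c a\<bar> * weight c N 0 a"
  define e where "e s = q powr (real N ^ 2 / 8 + (real s ^ 2 - real s - 1) / 2 - parity_shift N)" for s :: nat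
  define G where "G k = pair_prod (\<lambda>i j. ?B (k i) (k j)) {1..r} * (\<Prod>i\<in>{1..r}. ?w (k i))" for k :: "nat \<Rightarrow> real"
  have summand: "(\<Prod>i\<in>{1..r}. \<Prod>j\<in>{i<..r}. \<bar>qbracket q (k i - k j) * qbracket q (k i + k j)\<bar>) *
      (\<Prod>i\<in>{1..r}. \<bar>qbracket q (k i)\<bar> * q powr (((k i - real r + real i) gchoose 2) - parity_shift N)
        * qbinomial q (int N) \<lfloor>real N / 2 + k i\<rfloor>) = (\<Prod>i\<in>{1..r}. e (r - i)) * G k"
    if k: "k \<in> {1..r} \<rightarrow>\<^sub>E ?U" for k
  proof -
    have pairs: "(\<Prod>j\<in>{i<..r}. \<bar>qbracket q (k i - k j) * qbracket q (k i + k j)\<bar>)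
        = q powr (real (r - i) * (k i - 1)) * (\<Prod>j\<in>{i<..r}. ?B (k i) (k j))" for i
      unfolding abs_qbracket_pair[OF assms(1,2)] c_def[symmetric] prod.distrib
      using assms(1) by (simp add: powr_power mult.commute)
    have "q powr (real (r - i) * (k i - 1)) * (\<bar>qbracket q (k i)\<bar>
        * q powr (((k i - real r + real i) gchoose 2) - parity_shift N) * qbinomial q (int N) \<lfloor>real N / 2 + k i\<rfloor>)
        = e (r - i) * ?w (k i)" if i: "i \<in> {1..r}" for i
    proof -
      have "k i - real r + real i = k i - real (r - i)"
        using i by (simp add: of_nat_diff)
      then show ?thesis
        unfolding e_def
        using summand_factor_eq[OF assms(1,2) PiE_mem[OF k i], of "real (r - i)" "parity_shift N"]
        unfolding c_def[symmetric] by (simp only:)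
    qed
    then have singles: "(\<Prod>i\<in>{1..r}. q powr (real (r - i) * (k i - 1)) * (\<bar>qbracket q (k i)\<bar>
        * q powr (((k i - real r + real i) gchoose 2) - parity_shift N) * qbinomial q (int N) \<lfloor>real N / 2 + k i\<rfloor>))
        = (\<Prod>i\<in>{1..r}. e (r - i) * ?w (k i))"
      by (rule prod.cong[OF refl])
    show ?thesis
      using singles unfolding pairs G_def pair_prod_atLeastAtMost prod.distrib by (simp add: mult_ac)
  qed
  have "(\<Sum>k\<in>{1..r} \<rightarrow>\<^sub>E ?U. G k) = (\<Sum>k\<in>{..<r} \<rightarrow>\<^sub>E ?U. pair_prod (\<lambda>i j. ?B (k i) (k j)) {..<r} * (\<Prod>i<r. ?w (k i)))"
  proof -
    have "pair_prod (\<lambda>i j. ?B (restrict (k \<circ> Suc) {..<r} i) (restrict (k \<circ> Suc) {..<r} j)) {..<r}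
        * (\<Prod>i<r. ?w (restrict (k \<circ> Suc) {..<r} i)) = G k" for k
    proof -
      have "pair_prod (\<lambda>i j. ?B (restrict (k \<circ> Suc) {..<r} i) (restrict (k \<circ> Suc) {..<r} j)) {..<r}
          = pair_prod (\<lambda>i j. ?B (k (Suc i)) (k (Suc j))) {..<r}"
        by (rule pair_prod_cong) simp
      also have "\<dots> = pair_prod (\<lambda>i j. ?B (k i) (k j)) {1..r}"
        by (rule pair_prod_reindex_sym[OF bij_betw_Suc_lessThan, where t = "\<lambda>i j. ?B (k i) (k j)"])
           (simp, rule abs_snum_pair_commute)
      finally have 1: "pair_prod (\<lambda>i j. ?B (restrict (k \<circ> Suc) {..<r} i) (restrict (k \<circ> Suc) {..<r} j)) {..<r}
          = pair_prod (\<lambda>i j. ?B (k i) (k j)) {1..r}" .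
      have "(\<Prod>i<r. ?w (restrict (k \<circ> Suc) {..<r} i)) = (\<Prod>i<r. ?w (k (Suc i)))"
        by (rule prod.cong) simp_all
      also have "\<dots> = (\<Prod>i\<in>{1..r}. ?w (k i))"
        by (rule prod.reindex_bij_betw[OF bij_betw_Suc_lessThan, where g = "\<lambda>i. ?w (k i)"])
      finally show ?thesis
        unfolding G_def 1 by (simp only:)
    qed
    then show ?thesis
      by (subst sum_PiE_reindex[OF bij_betw_Suc_lessThan]) (simp only:)
  qed
  also note sum_symmetric_form[OF c bound]
  finally have sum_G: "(\<Sum>k\<in>{1..r} \<rightarrow>\<^sub>E ?U. G k) = fact r * (\<Prod>j<r. 2 * tail c N j 0
        * (\<Prod>a<j. snum c (real (N - 2 * a)) * snum c (real (N - 2 * a - 1)))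
        * (\<Prod>i<j. snum c (real j - real i) / snum c (real N - real i - real j)))" .
  define R where "R i = qpoch (- q) (sqrt q) (int N - 2 * int i) * (qGamma q (real i) / qGamma q (3 / 2))
      * (qGamma q (real N + 1) * qGamma q (real (Suc N div 2) - real i + 3 / 2)
        / (qGamma q (real N - real i + 2) * qGamma q (real (Suc N div 2) - real i + 1)))" for i
  have R_Suc: "R (Suc j) = e j * (tail c N j 0
      * (\<Prod>a<j. snum c (real (N - 2 * a)) * snum c (real (N - 2 * a - 1)))
      * (\<Prod>i<j. snum c (real j - real i) / snum c (real N - real i - real j)))" if "j < r" for j
    unfolding R_def e_def c_def by (rule qGamma_factor_eq[OF assms(1,2)]) (use that bound in simp)
  have e_reverse: "(\<Prod>i\<in>{1..r}. e (r - i)) = (\<Prod>j<r. e j)"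
    by (rule prod.reindex_bij_witness[of _ "\<lambda>j. r - j" "\<lambda>i. r - i"]) auto
  have "(\<Sum>k\<in>{1..r} \<rightarrow>\<^sub>E ?U.
      (\<Prod>i\<in>{1..r}. \<Prod>j\<in>{i<..r}. \<bar>qbracket q (k i - k j) * qbracket q (k i + k j)\<bar>) *
      (\<Prod>i\<in>{1..r}. \<bar>qbracket q (k i)\<bar> * q powr (((k i - real r + real i) gchoose 2) - parity_shift N)
        * qbinomial q (int N) \<lfloor>real N / 2 + k i\<rfloor>))
      = (\<Sum>k\<in>{1..r} \<rightarrow>\<^sub>E ?U. (\<Prod>i\<in>{1..r}. e (r - i)) * G k)"
    by (rule sum.cong[OF refl summand])
  also have "\<dots> = fact r * (\<Prod>j<r. 2 * R (Suc j))"
  proof -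
    have "(\<Prod>j<r. 2 * R (Suc j)) = (\<Prod>j<r. e j * (2 * tail c N j 0
        * (\<Prod>a<j. snum c (real (N - 2 * a)) * snum c (real (N - 2 * a - 1)))
        * (\<Prod>i<j. snum c (real j - real i) / snum c (real N - real i - real j))))"
      by (rule prod.cong[OF refl]) (simp add: R_Suc)
    then show ?thesis
      unfolding sum_distrib_left[symmetric] sum_G e_reverse prod.distrib by (simp only: mult_ac)
  qed
  also have "(\<Prod>j<r. 2 * R (Suc j)) = 2 ^ r * (\<Prod>i\<in>{1..r}. R i)"
    unfolding prod.reindex_bij_betw[OF bij_betw_Suc_lessThan, symmetric] by (simp add: prod.distrib)
  finally show ?thesis
    unfolding n floor parity_shift_eq unfolding ceiling_half R_def by (simp add: mult_ac)
qed

end
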